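(* For a partition $\lambda$ let $f^\lambda=|\mathrm{SYT}(\lambda)|$. Then for $p\in\{132,213\}$, $$\left|\bigcup_{\sigma\in\mathfrak{S}_n(p)}\mathcal{R}(\sigma)\right|=\sum_{\lambda\subset\mathrm{sc}_n} f^\lambda.$$
   Context: $\mathfrak{S}_n(p)$ is the set of permutations in $\mathfrak{S}_n$ avoiding the pattern $p$ (i.e. whose one-line word has no subsequence in the same relative order as $p$). $\mathcal{R}(\sigma)$ is the set of reduced words of $\sigma\in\mathfrak{S}_n$: words $w_1\cdots w_m$ with letters in $\{1,\dots,n-1\}$, $m=\mathrm{inv}(\sigma)$, with $\sigma=s_{w_1}\cdots s_{w_m}$, where $s_i=(i\ i{+}1)$ acts on positions, composing from the left (start with $12\cdots n$ and successively swap the entries in positions $w_k$ and $w_k+1$). $\mathrm{SYT}(\lambda)$ is the set of standard Young tableaux of shape $\lambda$, $\mathrm{sc}_n=(n-1,n-2,\dots,1)$ is the staircase partition, and $\lambda\subset\mathrm{sc}_n$ ranges over all partitions (including the empty one) whose Young diagram is contained in that of $\mathrm{sc}_n$. *)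

theory Defs
  imports
    "HOL-Library.FuncSet"
    "HOL-Library.Sublist"
    "HOL-Combinatorics.Permutations"
begin

text \<open>Elements of the symmetric group on \<open>{1..n}\<close> are functions \<open>\<sigma>\<close> with \<open>\<sigma> permutes {1..n}\<close>.\<close>

definition one_line :: "nat \<Rightarrow> (nat \<Rightarrow> nat) \<Rightarrow> nat list" where
  "one_line n \<sigma> = map \<sigma> [1..<Suc n]"

definition same_order :: "nat list \<Rightarrow> nat list \<Rightarrow> bool" where
  "same_order u p \<longleftrightarrow> length u = length p \<and>
     (\<forall>i<length p. \<forall>j<length p. u ! i < u ! j \<longleftrightarrow> p ! i < p ! j)"

definition avoids :: "nat list \<Rightarrow> nat list \<Rightarrow> bool" where
  "avoids w p \<longleftrightarrow> \<not> (\<exists>u. subseq u w \<and> same_order u p)"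

definition avoiding_perms :: "nat \<Rightarrow> nat list \<Rightarrow> (nat \<Rightarrow> nat) set" where
  "avoiding_perms n p = {\<sigma>. \<sigma> permutes {1..n} \<and> avoids (one_line n \<sigma>) p}"

definition inv_count :: "nat \<Rightarrow> (nat \<Rightarrow> nat) \<Rightarrow> nat" where
  "inv_count n \<sigma> = card {(i, j). 1 \<le> i \<and> i < j \<and> j \<le> n \<and> \<sigma> j < \<sigma> i}"

text \<open>Precomposing with \<open>transpose i (Suc i)\<close> swaps the entries in positions \<open>i\<close> and \<open>i + 1\<close>
  of the one-line word.\<close>

definition word_perm :: "nat list \<Rightarrow> nat \<Rightarrow> nat" where
  "word_perm w = foldl (\<lambda>\<tau> i. \<tau> \<circ> transpose i (Suc i)) id w"

definition reduced_words :: "nat \<Rightarrow> (nat \<Rightarrow> nat) \<Rightarrow> nat list set" where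
  "reduced_words n \<sigma> =
     {w. set w \<subseteq> {1..<n} \<and> length w = inv_count n \<sigma> \<and> word_perm w = \<sigma>}"

text \<open>A partition is the list of its nonzero parts, so that each partition has exactly one
  representation. Cells are indexed from \<open>(0, 0)\<close>, row first.\<close>

definition is_partition :: "nat list \<Rightarrow> bool" where
  "is_partition l \<longleftrightarrow> sorted_wrt (\<ge>) l \<and> 0 \<notin> set l"

definition young_diagram :: "nat list \<Rightarrow> (nat \<times> nat) set" where
  "young_diagram l = {(i, j). i < length l \<and> j < l ! i}"

text \<open>Fillings are \<open>undefined\<close> outside the diagram, so that distinct functions are distinct
  tableaux.\<close>

definition SYT :: "nat list \<Rightarrow> (nat \<times> nat \<Rightarrow> nat) set" where
  "SYT l = {T \<in> extensional (young_diagram l).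
     bij_betw T (young_diagram l) {1..sum_list l} \<and>
     (\<forall>i j k. j < k \<and> (i, k) \<in> young_diagram l \<longrightarrow> T (i, j) < T (i, k)) \<and>
     (\<forall>i j k. i < k \<and> (k, j) \<in> young_diagram l \<longrightarrow> T (i, j) < T (k, j))}"

definition num_SYT :: "nat list \<Rightarrow> nat" where
  "num_SYT l = card (SYT l)"

definition staircase :: "nat \<Rightarrow> nat list" where
  "staircase n = rev [1..<n]"

definition partitions_in :: "nat list \<Rightarrow> nat list set" where
  "partitions_in m = {l. is_partition l \<and> young_diagram l \<subseteq> young_diagram m}"

text \<open>The sum over \<open>partitions_in m\<close> is a sum over a finite set, and the sets counted
  by the cardinalities are finite.\<close>

lemma finite_partitions_in: "finite (partitions_in m)"
proof -
  have "partitions_in m \<subseteq> {l. set l \<subseteq> {..sum_list m} \<and> length l \<le> length m}"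
  proof
    fix l assume l: "l \<in> partitions_in m"
    have pos: "0 < l ! i" if "i < length l" for i
      using l that unfolding partitions_in_def is_partition_def by (metis (mono_tags, lifting)
        gr0I mem_Collect_eq nth_mem)
    have cell: "i < length m \<and> l ! i - 1 < m ! i" if "i < length l" for i
    proof -
      have "(i, l ! i - 1) \<in> young_diagram l" using pos[OF that] that
        by (simp add: young_diagram_def)
      then show ?thesis using l by (auto simp: partitions_in_def young_diagram_def)
    qed
    have "length l \<le> length m" using cell by (metis leI less_irrefl)
    moreover have "x \<le> sum_list m" if x: "x \<in> set l" for x
    proof -
      from x obtain i where i: "i < length l" "l ! i = x" by (auto simp: in_set_conv_nth)
      have "x \<le> m ! i" using cell[OF i(1)] i(2) by linarith
      also have "\<dots> \<le> sum_list m" using cell[OF i(1)] by (simp add: member_le_sum_list)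
      finally show ?thesis .
    qed
    ultimately show "l \<in> {l. set l \<subseteq> {..sum_list m} \<and> length l \<le> length m}" by auto
  qed
  then show ?thesis by (rule finite_subset) (rule finite_lists_length_le, simp)
qed

lemma finite_SYT: "finite (SYT l)"
proof -
  have "young_diagram l = (SIGMA i:{..<length l}. {..<l ! i})"
    by (auto simp: young_diagram_def)
  then have fin: "finite (young_diagram l)" by simp
  have "SYT l \<subseteq> young_diagram l \<rightarrow>\<^sub>E {1..sum_list l}"
    by (auto simp: SYT_def PiE_def bij_betw_def)
  then show ?thesis by (rule finite_subset) (simp add: fin finite_PiE)
qed

lemma finite_reduced_words_avoiding:
  "finite (\<Union>\<sigma>\<in>avoiding_perms n p. reduced_words n \<sigma>)"
proof (rule finite_UN_I)
  show "finite (avoiding_perms n p)"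
    by (rule finite_subset[OF _ finite_permutations[of "{1..n}"]])
       (auto simp: avoiding_perms_def)
  show "finite (reduced_words n \<sigma>)" for \<sigma>
    by (rule finite_subset[OF _ finite_lists_length_eq[of "{1..<n}" "inv_count n \<sigma>"]])
       (auto simp: reduced_words_def)
qed

end

theory Submission
  imports Defs
begin

text \<open>
  The sets of reduced words of different permutations are disjoint, so the theorem follows once the
  132-avoiding permutations are put in bijection with the partitions inside the staircase, in such a
  way that a permutation with partition \<open>\<lambda>\<close> has \<open>f\<^sup>\<lambda>\<close> reduced words. The pattern 213 reduces to 132
  by conjugation with the longest permutation, which replaces each letter \<open>i\<close> of a word by \<open>n - i\<close>.

  The bijection is the Lehmer code: 132-avoiding permutations, called dominant, are those whose code
  is weakly decreasing, and the code of a permutation of \<open>{1..n}\<close> lies under the staircase. Descents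
  of a dominant permutation correspond to corners of its diagram.

  It remains to see that the number \<open>r\<close> of reduced words obeys the recursion of the number of
  standard tableaux, which removes one corner at a time (\<open>card_tableaux_eq_sum_corners\<close>).
  Removing the last letter gives \<open>r(\<sigma>) = \<Sum> r(\<sigma> s\<^sub>i)\<close>, summed over the descents \<open>i\<close> of \<open>\<sigma>\<close>, but
  \<open>\<sigma> s\<^sub>i\<close> is usually not dominant. Let \<open>\<sigma>'\<close> be the dominant permutation whose diagram lacks the corner
  that belongs to \<open>i\<close>. The key fact is \<open>r(\<sigma> s\<^sub>i) = r(\<sigma>')\<close> (\<open>num_red_next_smaller\<close>). It is a
  degenerate case of the identity
  \<open>\<Sum>\<^sub>j\<^sub>>\<^sub>k r(u t\<^sub>k\<^sub>j) = \<Sum>\<^sub>j\<^sub><\<^sub>k r(u t\<^sub>j\<^sub>k)\<close>, where both sums range over the covers of \<open>u\<close> in Bruhat order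
  (\<open>transition\<close>). For \<open>u = \<sigma>' s\<^sub>i\<close> and \<open>k = i + 1\<close> each sum has a single term.

  The identity itself is proved by induction on length, stripping the first letter of reduced words.
  This acts on values while the covers act on positions, so the two operations nearly commute
  (\<open>cover_term_left_descents\<close>), and the few terms by which they fail to do so cancel.
\<close>

section \<open>Reduced words, and removing their last or first letter\<close>

abbreviation swap :: "nat \<Rightarrow> nat \<Rightarrow> nat" where
  "swap i \<equiv> transpose i (Suc i)"

definition inversions :: "(nat \<Rightarrow> nat) \<Rightarrow> (nat \<times> nat) set" where
  "inversions \<sigma> = {(i, j). i < j \<and> \<sigma> j < \<sigma> i}"

abbreviation len :: "(nat \<Rightarrow> nat) \<Rightarrow> nat" where
  "len \<sigma> \<equiv> card (inversions \<sigma>)"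

lemma inversions_id [simp]: "inversions id = {}"
  by (auto simp: inversions_def)

text \<open>These are the reduced words of \<open>\<sigma>\<close> over the whole alphabet of natural numbers, so that no
  ambient \<open>n\<close> has to be carried along. A reduced word of a permutation of \<open>{1..n}\<close> automatically
  has its letters in \<open>{1..<n}\<close>, see \<open>reduced_words_eq_red\<close>.\<close>

definition red :: "(nat \<Rightarrow> nat) \<Rightarrow> nat list set" where
  "red \<sigma> = {w. length w = len \<sigma> \<and> word_perm w = \<sigma>}"

abbreviation num_red :: "(nat \<Rightarrow> nat) \<Rightarrow> nat" where
  "num_red \<sigma> \<equiv> card (red \<sigma>)"

lemma word_perm_Nil [simp]: "word_perm [] = id"
  by (simp add: word_perm_def)

lemma word_perm_snoc [simp]: "word_perm (w @ [i]) = word_perm w \<circ> swap i"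
  by (simp add: word_perm_def)

lemma permutation_comp_swap_iff: "permutation (\<sigma> \<circ> swap i) \<longleftrightarrow> permutation \<sigma>"
proof -
  have "permutation \<sigma>" if "permutation (\<sigma> \<circ> swap i)"
    using permutation_compose[OF that permutation_swap_id[of i "Suc i"]]
    by (simp add: comp_assoc)
  then show ?thesis
    by (auto intro: permutation_compose permutation_swap_id)
qed

lemma permutation_word_perm: "permutation (word_perm w)"
proof (induction w rule: rev_induct)
  case Nil
  show ?case unfolding word_perm_Nil by (simp add: permutation)
next
  case (snoc i w)
  then show ?case unfolding word_perm_snoc permutation_comp_swap_iff .
qed

lemma finite_inversions:
  assumes "permutation \<sigma>"
  shows "finite (inversions \<sigma>)"
proof -
  have bij: "bij \<sigma>" and fin: "finite {x. \<sigma> x \<noteq> x}"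
    using assms by (auto simp: permutation)
  obtain N where N: "\<And>x. \<sigma> x \<noteq> x \<Longrightarrow> x < N"
    using fin unfolding finite_nat_set_iff_bounded by auto
  have "j < N" if "i < j" "\<sigma> j < \<sigma> i" for i j
  proof (rule ccontr)
    assume "\<not> j < N"
    then have "\<sigma> j = j" using N by blast
    then have "\<sigma> (\<sigma> i) = \<sigma> i" using that \<open>\<not> j < N\<close> N[of "\<sigma> i"] by force
    then have "\<sigma> i = i" using bij by (simp add: bij_is_inj inj_eq)
    then show False using that \<open>\<sigma> j = j\<close> by simp
  qed
  then have "inversions \<sigma> \<subseteq> {..<N} \<times> {..<N}"
    by (force simp: inversions_def)
  then show ?thesis by (rule finite_subset) simp
qed

text \<open>Moving both members of a pair of positions by \<open>swap i\<close> matches the inversions of the two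
  permutations, with the single exception of the pair \<open>(i, i + 1)\<close> itself.\<close>

lemma len_comp_swap_ascent:
  assumes "permutation \<sigma>" "\<sigma> i < \<sigma> (Suc i)"
  shows "len (\<sigma> \<circ> swap i) = Suc (len \<sigma>)"
proof -
  have "inversions (\<sigma> \<circ> swap i) = insert (i, Suc i) (map_prod (swap i) (swap i) ` inversions \<sigma>)"
    (is "?L = ?R")
  proof (rule set_eqI)
    fix x :: "nat \<times> nat"
    obtain a b where x: "x = (a, b)" by (cases x)
    have "x \<in> map_prod (swap i) (swap i) ` inversions \<sigma> \<longleftrightarrow> (swap i a, swap i b) \<in> inversions \<sigma>"
      unfolding x by (force simp: image_iff)
    then show "x \<in> ?L \<longleftrightarrow> x \<in> ?R"
      using assms(2) unfolding x inversions_def by (auto simp: transpose_def)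
  qed
  moreover have "(i, Suc i) \<notin> map_prod (swap i) (swap i) ` inversions \<sigma>"
  proof
    assume "(i, Suc i) \<in> map_prod (swap i) (swap i) ` inversions \<sigma>"
    then obtain a b where "(a, b) \<in> inversions \<sigma>" "i = swap i a" "Suc i = swap i b" by auto
    then show False
      by (auto simp: inversions_def transpose_def split: if_splits)
  qed
  moreover have "inj (map_prod (swap i) (swap i))"
    by (simp add: prod.inj_map)
  ultimately show ?thesis
    using finite_inversions[OF assms(1)] by (simp add: card_image inj_on_subset)
qed

lemma len_comp_swap_descent:
  assumes "permutation \<sigma>" "\<sigma> (Suc i) < \<sigma> i"
  shows "len \<sigma> = Suc (len (\<sigma> \<circ> swap i))"
  using len_comp_swap_ascent[of "\<sigma> \<circ> swap i" i] assms
  by (simp add: permutation_comp_swap_iff comp_assoc)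

lemma len_word_perm_le: "len (word_perm w) \<le> length w"
proof (induction w rule: rev_induct)
  case Nil
  show ?case unfolding word_perm_Nil using inversions_id by (simp add: id_def)
next
  case (snoc i w)
  let ?s = "word_perm w"
  have inj: "?s i \<noteq> ?s (Suc i)"
    using permutation_word_perm[of w]
    by (metis bij_is_inj inj_eq n_not_Suc_n permutation)
  then consider "?s i < ?s (Suc i)" | "?s (Suc i) < ?s i" by linarith
  then have "len (?s \<circ> swap i) \<le> Suc (length w)"
    using snoc len_comp_swap_ascent[OF permutation_word_perm, of w i]
      len_comp_swap_descent[OF permutation_word_perm, of w i]
    by cases linarith+
  then show ?case by (simp only: word_perm_snoc length_append_singleton)
qed

text \<open>A word is never shorter than the length of its product. So the prefix \<open>w\<close> forces the last
  letter to shorten \<open>\<sigma>\<close>, and \<open>w\<close> is then itself reduced.\<close>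

lemma snoc_mem_red_iff:
  assumes "permutation \<sigma>"
  shows "w @ [i] \<in> red \<sigma> \<longleftrightarrow> \<sigma> (Suc i) < \<sigma> i \<and> w \<in> red (\<sigma> \<circ> swap i)"
proof
  assume w: "w @ [i] \<in> red \<sigma>"
  then have wp: "word_perm w = \<sigma> \<circ> swap i"
    by (auto simp: red_def comp_assoc)
  then have le: "len (\<sigma> \<circ> swap i) \<le> length w"
    using len_word_perm_le[of w] by simp
  have "\<sigma> i \<noteq> \<sigma> (Suc i)"
    using assms by (metis bij_is_inj inj_eq n_not_Suc_n permutation)
  then have desc: "\<sigma> (Suc i) < \<sigma> i"
    using len_comp_swap_ascent[OF assms, of i] w le by (force simp: red_def)
  show "\<sigma> (Suc i) < \<sigma> i \<and> w \<in> red (\<sigma> \<circ> swap i)"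
    using desc wp w len_comp_swap_descent[OF assms desc] by (simp add: red_def)
next
  assume "\<sigma> (Suc i) < \<sigma> i \<and> w \<in> red (\<sigma> \<circ> swap i)"
  then show "w @ [i] \<in> red \<sigma>"
    using len_comp_swap_descent[OF assms, of i] by (simp add: red_def comp_assoc)
qed

lemma Nil_mem_red_iff: "[] \<in> red \<sigma> \<longleftrightarrow> \<sigma> = id"
  by (auto simp: red_def)

lemma red_eq_UN_descents:
  assumes "permutation \<sigma>" "\<sigma> \<noteq> id"
  shows "red \<sigma> = (\<Union>i\<in>{i. \<sigma> (Suc i) < \<sigma> i}. (\<lambda>w. w @ [i]) ` red (\<sigma> \<circ> swap i))"
proof (rule set_eqI)
  fix w
  show "w \<in> red \<sigma> \<longleftrightarrow> w \<in> (\<Union>i\<in>{i. \<sigma> (Suc i) < \<sigma> i}. (\<lambda>w. w @ [i]) ` red (\<sigma> \<circ> swap i))"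
    by (cases w rule: rev_cases) (use assms in \<open>auto simp: Nil_mem_red_iff snoc_mem_red_iff\<close>)
qed

lemma finite_descents:
  assumes "permutation \<sigma>"
  shows "finite {i. \<sigma> (Suc i) < \<sigma> i}"
  by (rule finite_surj[OF finite_inversions[OF assms], of _ fst])
     (force simp: inversions_def image_iff)

lemma red_id: "red id = {[]}"
  by (auto simp: red_def)

lemma finite_red: "permutation \<sigma> \<Longrightarrow> finite (red \<sigma>)"
proof (induction "len \<sigma>" arbitrary: \<sigma> rule: less_induct)
  case less
  show ?case
  proof (cases "\<sigma> = id")
    case False
    have "finite (red (\<sigma> \<circ> swap i))" if "\<sigma> (Suc i) < \<sigma> i" for i
      using less.hyps[of "\<sigma> \<circ> swap i"] len_comp_swap_descent[OF less.prems that] less.prems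
      by (simp add: permutation_comp_swap_iff)
    then show ?thesis
      unfolding red_eq_UN_descents[OF less.prems False]
      using finite_descents[OF less.prems] by blast
  qed (simp add: red_id)
qed

lemma num_red_eq_sum_descents:
  assumes "permutation \<sigma>" "\<sigma> \<noteq> id"
  shows "num_red \<sigma> = (\<Sum>i | \<sigma> (Suc i) < \<sigma> i. num_red (\<sigma> \<circ> swap i))"
proof -
  have "num_red \<sigma> = (\<Sum>i | \<sigma> (Suc i) < \<sigma> i. card ((\<lambda>w. w @ [i]) ` red (\<sigma> \<circ> swap i)))"
    unfolding red_eq_UN_descents[OF assms]
    by (rule card_UN_disjoint)
       (use assms in \<open>auto simp: finite_descents finite_red permutation_comp_swap_iff\<close>)
  also have "\<dots> = (\<Sum>i | \<sigma> (Suc i) < \<sigma> i. num_red (\<sigma> \<circ> swap i))"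
    by (intro sum.cong refl card_image) (simp add: inj_on_def)
  finally show ?thesis .
qed

lemma word_perm_rev: "word_perm (rev w) = inv (word_perm w)"
proof -
  have *: "word_perm (i # w) = swap i \<circ> word_perm w" for i w
    by (induction w rule: rev_induct)
       (simp_all add: word_perm_def comp_assoc)
  show ?thesis
  proof (induction w rule: rev_induct)
    case (snoc i w)
    have "bij (word_perm w)" using permutation_word_perm[of w] by (simp add: permutation)
    then show ?case
      using snoc.IH by (simp only: * rev_append rev.simps append.simps word_perm_snoc
        o_inv_distrib bij_transpose inv_transpose_eq)
  qed (simp add: inv_id)
qed

text \<open>Exchanging the roles of positions and values turns inversions of \<open>\<sigma>\<close> into inversions of its
  inverse.\<close>

lemma len_inv:
  assumes "permutation \<sigma>"
  shows "len (inv \<sigma>) = len \<sigma>"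
proof -
  have bij: "bij \<sigma>" using assms by (simp add: permutation)
  have "bij_betw (\<lambda>(i, j). (\<sigma> j, \<sigma> i)) (inversions \<sigma>) (inversions (inv \<sigma>))"
  proof (rule bij_betwI[where g = "\<lambda>(i, j). (inv \<sigma> j, inv \<sigma> i)"])
  qed (use bij in \<open>auto simp: inversions_def bij_is_inj bij_is_surj surj_f_inv_f\<close>)
  then show ?thesis by (metis bij_betw_same_card)
qed

lemma num_red_inv:
  assumes "permutation \<sigma>"
  shows "num_red (inv \<sigma>) = num_red \<sigma>"
proof -
  have bij: "bij \<sigma>" using assms by (simp add: permutation)
  have "bij_betw rev (red \<sigma>) (red (inv \<sigma>))"
    by (rule bij_betwI[where g = rev])
       (use assms bij in \<open>auto simp: red_def word_perm_rev len_inv inv_inv_eq\<close>)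
  then show ?thesis by (metis bij_betw_same_card)
qed

text \<open>Letters with which a reduced word of \<open>\<sigma>\<close> may start. In the one-line word they are the
  values \<open>i\<close> that occur to the right of \<open>i + 1\<close>; the positions are kept as witnesses to avoid the
  inverse permutation.\<close>

definition left_descents :: "(nat \<Rightarrow> nat) \<Rightarrow> nat set" where
  "left_descents \<sigma> = {i. \<exists>p q. q < p \<and> \<sigma> p = i \<and> \<sigma> q = Suc i}"

lemma left_descents_inv:
  assumes "bij \<sigma>"
  shows "left_descents \<sigma> = {i. inv \<sigma> (Suc i) < inv \<sigma> i}"
  using assms unfolding left_descents_def
  by (auto simp: bij_is_inj bij_is_surj surj_f_inv_f) (metis bij_inv_eq_iff)+

lemma inv_comp_swap:
  assumes "bij \<sigma>"
  shows "inv \<sigma> \<circ> swap i = inv (swap i \<circ> \<sigma>)"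
  using assms by (simp add: o_inv_distrib)

lemma permutation_swap_comp: "permutation \<sigma> \<Longrightarrow> permutation (swap i \<circ> \<sigma>)"
  by (intro permutation_compose permutation_swap_id)

text \<open>Removing the first letter is removing the last letter of the reversed word, which is a
  reduced word of the inverse permutation.\<close>

lemma num_red_eq_sum_left_descents:
  assumes "permutation \<sigma>" "\<sigma> \<noteq> id"
  shows "num_red \<sigma> = (\<Sum>i\<in>left_descents \<sigma>. num_red (swap i \<circ> \<sigma>))"
proof -
  have bij: "bij \<sigma>" using assms by (simp add: permutation)
  have "inv \<sigma> \<noteq> id" using assms bij by (metis inv_id inv_inv_eq)
  then have "num_red (inv \<sigma>) = (\<Sum>i | inv \<sigma> (Suc i) < inv \<sigma> i. num_red (inv \<sigma> \<circ> swap i))"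
    using assms by (intro num_red_eq_sum_descents) (simp add: permutation_inverse)
  then show ?thesis
    using assms bij by (simp add: num_red_inv left_descents_inv inv_comp_swap permutation_swap_comp)
qed

lemma len_left_descent:
  assumes "permutation \<sigma>" "i \<in> left_descents \<sigma>"
  shows "len (swap i \<circ> \<sigma>) < len \<sigma>"
proof -
  have bij: "bij \<sigma>" using assms by (simp add: permutation)
  have "len (inv \<sigma>) = Suc (len (inv \<sigma> \<circ> swap i))"
    using assms bij
    by (intro len_comp_swap_descent) (simp_all add: permutation_inverse left_descents_inv)
  then show ?thesis
    using assms bij by (simp add: inv_comp_swap len_inv permutation_swap_comp)
qed

text \<open>A permutation of \<open>{1..n}\<close> has all its descents in \<open>{1..<n}\<close>, so stripping last letters from
  a reduced word never leaves the symmetric group on \<open>{1..n}\<close>.\<close>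

lemma reduced_words_eq_red:
  assumes "\<sigma> permutes {1..n}"
  shows "reduced_words n \<sigma> = red \<sigma>"
proof -
  have mem: "1 \<le> i \<and> j \<le> n" if "\<tau> permutes {1..n}" "i < j" "\<tau> j < \<tau> i" for \<tau> i j
  proof -
    have "j \<in> {1..n}"
    proof (rule ccontr)
      assume j: "j \<notin> {1..n}"
      then have "\<tau> j = j" using that(1) by (simp add: permutes_not_in)
      then show False
        using that j permutes_in_image[OF that(1), of i] permutes_not_in[OF that(1), of i]
        by (cases "i \<in> {1..n}") auto
    qed
    moreover have "i \<noteq> 0" using that permutes_not_in[OF that(1), of 0] by (intro notI) simp
    ultimately show ?thesis by simp
  qed
  have "inversions \<sigma> = {(i, j). 1 \<le> i \<and> i < j \<and> j \<le> n \<and> \<sigma> j < \<sigma> i}"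
    using mem[OF assms] by (auto simp: inversions_def)
  then have len: "len \<sigma> = inv_count n \<sigma>" by (simp add: inv_count_def)
  have "w \<in> red \<tau> \<Longrightarrow> \<tau> permutes {1..n} \<Longrightarrow> set w \<subseteq> {1..<n}" for w \<tau>
  proof (induction w arbitrary: \<tau> rule: rev_induct)
    case (snoc i w)
    have "permutation \<tau>" using snoc.prems by (auto simp: permutation_permutes)
    then have i: "\<tau> (Suc i) < \<tau> i" and w: "w \<in> red (\<tau> \<circ> swap i)"
      using snoc.prems by (simp_all add: snoc_mem_red_iff)
    have "i \<in> {1..<n}" using mem[OF snoc.prems(2) _ i] by simp
    moreover from this have "\<tau> \<circ> swap i permutes {1..n}"
      by (intro permutes_compose[OF permutes_swap_id] snoc.prems) auto
    ultimately have "set w \<subseteq> {1..<n}" by (intro snoc.IH[OF w])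
    then show ?case using \<open>i \<in> {1..<n}\<close> by simp
  qed simp
  from this[OF _ assms] len show ?thesis by (auto simp: reduced_words_def red_def)
qed

section \<open>The transition identity for numbers of reduced words\<close>

text \<open>Exchanging the entries in positions \<open>a < b\<close> raises the number of inversions by exactly one
  under this condition. It is stated in terms of entries so that the lengths of the permutations
  \<open>\<sigma> \<circ> transpose a b\<close> never have to be computed.\<close>

definition bruhat_cover :: "(nat \<Rightarrow> nat) \<Rightarrow> nat \<Rightarrow> nat \<Rightarrow> bool" where
  "bruhat_cover \<sigma> a b \<longleftrightarrow>
     a < b \<and> \<sigma> a < \<sigma> b \<and> (\<forall>c. a < c \<and> c < b \<longrightarrow> \<not> (\<sigma> a < \<sigma> c \<and> \<sigma> c < \<sigma> b))"

lemma left_descents_iff: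
  assumes "inj \<sigma>" "\<sigma> p = i" "\<sigma> q = Suc i"
  shows "i \<in> left_descents \<sigma> \<longleftrightarrow> q < p"
proof -
  have "\<sigma> x = i \<longleftrightarrow> x = p" "\<sigma> x = Suc i \<longleftrightarrow> x = q" for x
    using assms by (metis inj_eq)+
  then show ?thesis unfolding left_descents_def by simp
qed

text \<open>Going up by \<open>transpose a b\<close> acts on positions and going down by \<open>swap i\<close> acts on values, so
  the two moves commute as maps. The lemma says that they also commute as moves, in the sense
  that one order of them is legitimate precisely if the other is, unless they exchange the same
  two entries. The reason is that \<open>swap i\<close> changes only the comparison between the values \<open>i\<close> and
  \<open>i + 1\<close>. So only the positions \<open>p\<close> and \<open>q\<close> of these values can matter, and a cover condition
  with one of them at its end keeps the other one out of the interval between \<open>a\<close> and \<open>b\<close>.\<close>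

lemma bruhat_cover_left_descent_iff:
  assumes "bij \<sigma>" "a < b"
    and "\<not> (\<sigma> a = i \<and> \<sigma> b = Suc i)" "\<not> (\<sigma> a = Suc i \<and> \<sigma> b = i)"
  shows "bruhat_cover \<sigma> a b \<and> i \<in> left_descents (\<sigma> \<circ> transpose a b) \<longleftrightarrow>
         i \<in> left_descents \<sigma> \<and> bruhat_cover (swap i \<circ> \<sigma>) a b"
proof -
  obtain p q where p: "\<sigma> p = i" and q: "\<sigma> q = Suc i"
    using assms(1) by (metis bij_pointE)
  have inj: "inj \<sigma>" using assms(1) by (rule bij_is_inj)
  have sp: "\<sigma> x = i \<longleftrightarrow> x = p" for x using p inj by (metis injD)
  have sq: "\<sigma> x = Suc i \<longleftrightarrow> x = q" for x using q inj by (metis injD)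
  have pq: "p \<noteq> q" using p q by auto
  have ld: "i \<in> left_descents \<sigma> \<longleftrightarrow> q < p"
    using inj p q by (rule left_descents_iff)
  have ldt: "i \<in> left_descents (\<sigma> \<circ> transpose a b) \<longleftrightarrow> transpose a b q < transpose a b p"
    using inj p q by (intro left_descents_iff) (auto intro: inj_compose)
  define \<tau> where "\<tau> = swap i \<circ> \<sigma>"
  have \<tau>p: "\<tau> p = Suc i" and \<tau>q: "\<tau> q = i"
    using p q by (simp_all add: \<tau>_def)
  have \<tau>: "\<tau> x = \<sigma> x" if "x \<noteq> p" "x \<noteq> q" for x
    using that sp[of x] sq[of x] by (simp add: \<tau>_def transpose_def)
  have ne: "\<sigma> x \<noteq> i" "\<sigma> x \<noteq> Suc i" if "x \<noteq> p" "x \<noteq> q" for x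
    using that sp[of x] sq[of x] by simp_all
  have less: "\<tau> x < \<tau> y \<longleftrightarrow> \<sigma> x < \<sigma> y" if "\<not> (x = p \<and> y = q)" "\<not> (x = q \<and> y = p)" for x y
    using that \<tau>p \<tau>q p q \<tau>[of x] \<tau>[of y] ne[of x] ne[of y]
    by (cases "x = p"; cases "x = q"; cases "y = p"; cases "y = q") auto
  have ab: "\<not> (a = p \<and> b = q)" "\<not> (a = q \<and> b = p)" using assms(3,4) p q by auto
  have lt_ab: "\<tau> a < \<tau> b \<longleftrightarrow> \<sigma> a < \<sigma> b" by (rule less[OF ab])
  (* K: no position other than p and q violates the cover condition *)
  define K where "K \<longleftrightarrow> (\<forall>c. c \<noteq> p \<and> c \<noteq> q \<and> a < c \<and> c < b \<longrightarrow> \<not> (\<sigma> a < \<sigma> c \<and> \<sigma> c < \<sigma> b))"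
  have K: "K \<longleftrightarrow> (\<forall>c. c \<noteq> p \<and> c \<noteq> q \<and> a < c \<and> c < b \<longrightarrow> \<not> (\<tau> a < \<tau> c \<and> \<tau> c < \<tau> b))"
  proof -
    have "\<tau> a < \<tau> c \<longleftrightarrow> \<sigma> a < \<sigma> c" "\<tau> c < \<tau> b \<longleftrightarrow> \<sigma> c < \<sigma> b" if "c \<noteq> p" "c \<noteq> q" for c
      using that by (intro less; simp)+
    then show ?thesis unfolding K_def by (intro iff_allI) simp
  qed
  have between_iff: "(\<forall>c. a < c \<and> c < b \<longrightarrow> Q c) \<longleftrightarrow>
      (\<forall>c. c \<noteq> p \<and> c \<noteq> q \<and> a < c \<and> c < b \<longrightarrow> Q c) \<and>
      (a < p \<and> p < b \<longrightarrow> Q p) \<and> (a < q \<and> q < b \<longrightarrow> Q q)" (is "?l \<longleftrightarrow> ?r") for Q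
  proof
    assume ?r
    show ?l
    proof (intro allI impI)
      fix c assume "a < c \<and> c < b"
      with \<open>?r\<close> show "Q c" by (cases "c = p"; cases "c = q") simp_all
    qed
  qed simp
  have cov: "bruhat_cover \<sigma> a b \<longleftrightarrow> \<sigma> a < \<sigma> b \<and> K \<and> \<not> (a < p \<and> p < b \<and> \<sigma> a < i \<and> i < \<sigma> b)
      \<and> \<not> (a < q \<and> q < b \<and> \<sigma> a < Suc i \<and> Suc i < \<sigma> b)"
    unfolding bruhat_cover_def between_iff[where Q = "\<lambda>c. \<not> (\<sigma> a < \<sigma> c \<and> \<sigma> c < \<sigma> b)"] K_def[symmetric]
    using assms(2) p q by auto
  have cov': "bruhat_cover \<tau> a b \<longleftrightarrow> \<sigma> a < \<sigma> b \<and> K \<and> \<not> (a < p \<and> p < b \<and> \<tau> a < Suc i \<and> Suc i < \<tau> b)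
      \<and> \<not> (a < q \<and> q < b \<and> \<tau> a < i \<and> i < \<tau> b)"
    unfolding bruhat_cover_def lt_ab between_iff[where Q = "\<lambda>c. \<not> (\<tau> a < \<tau> c \<and> \<tau> c < \<tau> b)"] K[symmetric]
    using assms(2) \<tau>p \<tau>q by auto
  note goal = ld ldt \<tau>_def[symmetric] cov cov'
  consider "a \<noteq> p" "a \<noteq> q" "b \<noteq> p" "b \<noteq> q" | "a = p" "b \<noteq> q" "b \<noteq> p"
    | "a = q" "b \<noteq> p" "b \<noteq> q" | "b = p" "a \<noteq> q" "a \<noteq> p" | "b = q" "a \<noteq> p" "a \<noteq> q"
    using ab assms(2) by blast
  then show ?thesis
  proof cases
    case 1
    have "\<sigma> a < Suc i \<longleftrightarrow> \<sigma> a < i" "Suc i < \<sigma> b \<longleftrightarrow> i < \<sigma> b"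
      using ne[of a] ne[of b] 1 by auto
    moreover have "\<tau> a = \<sigma> a" "\<tau> b = \<sigma> b" "transpose a b p = p" "transpose a b q = q"
      using 1 \<tau> by simp_all
    ultimately show ?thesis unfolding goal by auto
  next
    case 2
    have "transpose a b p = b" "transpose a b q = q" using 2 pq by simp_all
    moreover have "Suc i < \<sigma> b \<longleftrightarrow> i < \<sigma> b" using ne[of b] 2 by auto
    moreover have "\<tau> b = \<sigma> b" using 2 \<tau> by simp
    ultimately show ?thesis
      unfolding goal using 2 p q \<tau>p \<tau>q pq assms(2) by auto
  next
    case 3
    have "transpose a b q = b" "transpose a b p = p" using 3 pq by simp_all
    moreover have "Suc i < \<sigma> b \<longleftrightarrow> i < \<sigma> b" using ne[of b] 3 by auto
    moreover have "\<tau> b = \<sigma> b" using 3 \<tau> by simp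
    ultimately show ?thesis
      unfolding goal using 3 p q \<tau>p \<tau>q pq assms(2) by auto
  next
    case 4
    have "transpose a b p = a" "transpose a b q = q" using 4 pq by simp_all
    moreover have "\<sigma> a < Suc i \<longleftrightarrow> \<sigma> a < i" using ne[of a] 4 by auto
    moreover have "\<tau> a = \<sigma> a" using 4 \<tau> by simp
    ultimately show ?thesis
      unfolding goal using 4 p q \<tau>p \<tau>q pq assms(2) by auto
  next
    case 5
    have "transpose a b q = a" "transpose a b p = p" using 5 pq by simp_all
    moreover have "\<sigma> a < Suc i \<longleftrightarrow> \<sigma> a < i" using ne[of a] 5 by auto
    moreover have "\<tau> a = \<sigma> a" using 5 \<tau> by simp
    ultimately show ?thesis
      unfolding goal using 5 p q \<tau>p \<tau>q pq assms(2) by auto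
  qed
qed

definition cover_term :: "(nat \<Rightarrow> nat) \<Rightarrow> nat \<Rightarrow> nat \<Rightarrow> nat" where
  "cover_term \<sigma> a b = (if bruhat_cover \<sigma> a b then num_red (\<sigma> \<circ> transpose a b) else 0)"

lemma finite_left_descents: "permutation \<sigma> \<Longrightarrow> finite (left_descents \<sigma>)"
  using finite_descents[of "inv \<sigma>"]
  by (simp add: permutation_inverse left_descents_inv permutation_bijective)

lemma sum_eq_except_one:
  fixes f g :: "'a \<Rightarrow> nat"
  assumes "finite I" "j \<in> I" "\<And>i. i \<in> I - {j} \<Longrightarrow> f i = g i"
  shows "sum f I + g j = sum g I + f j"
  using assms by (simp add: sum.remove[of I j])

text \<open>Expand the number of reduced words of \<open>\<sigma> \<circ> transpose a b\<close> along first letters and commute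
  the two moves. The exceptional pairs of moves, which exchange the same two entries, lead back
  to \<open>\<sigma>\<close> and yield the two correction terms: if \<open>\<sigma> b = \<sigma> a + 1\<close> one can go up and down again, and
  if \<open>\<sigma> a = \<sigma> b + 1\<close> one can go down and up again.\<close>

lemma cover_term_left_descents:
  assumes perm: "permutation \<sigma>" and ab: "a < b"
  shows "cover_term \<sigma> a b + (if \<sigma> a = Suc (\<sigma> b) then num_red \<sigma> else 0) =
    (\<Sum>i\<in>left_descents \<sigma>. cover_term (swap i \<circ> \<sigma>) a b) +
    (if \<sigma> b = Suc (\<sigma> a) then num_red \<sigma> else 0)"
proof -
  let ?t = "transpose a b"
  have bij: "bij \<sigma>" using perm by (rule permutation_bijective)
  have permt: "permutation (\<sigma> \<circ> ?t)"
    by (intro permutation_compose permutation_swap_id perm)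
  define I where "I = insert (\<sigma> a) (insert (\<sigma> b) (left_descents \<sigma> \<union> left_descents (\<sigma> \<circ> ?t)))"
  have fin: "finite I" using perm permt by (simp add: I_def finite_left_descents)
  define f where "f i = (if bruhat_cover \<sigma> a b \<and> i \<in> left_descents (\<sigma> \<circ> ?t)
      then num_red (swap i \<circ> \<sigma> \<circ> ?t) else 0)" for i
  define g where "g i = (if i \<in> left_descents \<sigma> \<and> bruhat_cover (swap i \<circ> \<sigma>) a b
      then num_red (swap i \<circ> \<sigma> \<circ> ?t) else 0)" for i
  have f: "cover_term \<sigma> a b = sum f I"
  proof (cases "bruhat_cover \<sigma> a b")
    case True
    then have "(\<sigma> \<circ> ?t) b < (\<sigma> \<circ> ?t) a" by (simp add: bruhat_cover_def)
    then have "\<sigma> \<circ> ?t \<noteq> id" using ab by (metis id_apply less_asym)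
    then have "cover_term \<sigma> a b = (\<Sum>i\<in>left_descents (\<sigma> \<circ> ?t). num_red (swap i \<circ> (\<sigma> \<circ> ?t)))"
      unfolding cover_term_def using True permt by (simp add: num_red_eq_sum_left_descents)
    also have "\<dots> = (\<Sum>i\<in>left_descents (\<sigma> \<circ> ?t). f i)"
      using True by (intro sum.cong) (simp_all add: f_def comp_assoc)
    also have "\<dots> = sum f I"
      using fin by (intro sum.mono_neutral_left) (auto simp: I_def f_def)
    finally show ?thesis .
  qed (simp add: cover_term_def f_def)
  have g: "(\<Sum>i\<in>left_descents \<sigma>. cover_term (swap i \<circ> \<sigma>) a b) = sum g I"
  proof -
    have "(\<Sum>i\<in>left_descents \<sigma>. cover_term (swap i \<circ> \<sigma>) a b) = (\<Sum>i\<in>left_descents \<sigma>. g i)"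
      by (intro sum.cong) (simp_all add: g_def cover_term_def)
    also have "\<dots> = sum g I"
      using fin by (intro sum.mono_neutral_left) (auto simp: I_def g_def)
    finally show ?thesis .
  qed
  have fg: "f i = g i" if "\<not> (\<sigma> a = i \<and> \<sigma> b = Suc i)" "\<not> (\<sigma> a = Suc i \<and> \<sigma> b = i)" for i
    unfolding f_def g_def bruhat_cover_left_descent_iff[OF bij ab that] ..
  have inj: "inj \<sigma>" using bij by (rule bij_is_inj)
  (* at the exceptional letters the two moves cancel *)
  have swap_values: "transpose (\<sigma> a) (\<sigma> b) \<circ> \<sigma> \<circ> ?t = \<sigma>"
    using inj by (auto simp: fun_eq_iff transpose_def inj_eq)
  consider "\<sigma> b = Suc (\<sigma> a)" | "\<sigma> a = Suc (\<sigma> b)" | "\<sigma> b \<noteq> Suc (\<sigma> a)" "\<sigma> a \<noteq> Suc (\<sigma> b)" by blast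
  then show ?thesis
  proof cases
    case 1
    let ?i = "\<sigma> a"
    have "sum f I + g ?i = sum g I + f ?i"
      using fin 1 by (intro sum_eq_except_one fg) (auto simp: I_def)
    moreover have "g ?i = 0"
      using ab left_descents_iff[OF inj refl 1] by (simp add: g_def)
    moreover have "f ?i = num_red \<sigma>"
    proof -
      have "bruhat_cover \<sigma> a b" using ab 1 by (auto simp: bruhat_cover_def)
      moreover have "?i \<in> left_descents (\<sigma> \<circ> ?t)"
        unfolding left_descents_def
        by (rule CollectI, rule exI[of _ b], rule exI[of _ a]) (use ab 1 in simp)
      ultimately show ?thesis using swap_values 1 by (simp add: f_def)
    qed
    ultimately show ?thesis using f g 1 by simp
  next
    case 2
    let ?i = "\<sigma> b"
    have "sum f I + g ?i = sum g I + f ?i"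
      using fin 2 by (intro sum_eq_except_one fg) (auto simp: I_def)
    moreover have "f ?i = 0"
      using 2 by (simp add: f_def bruhat_cover_def)
    moreover have "g ?i = num_red \<sigma>"
    proof -
      have "bruhat_cover (swap ?i \<circ> \<sigma>) a b"
        using ab 2 by (auto simp: bruhat_cover_def)
      moreover have "?i \<in> left_descents \<sigma>"
        unfolding left_descents_def
        by (rule CollectI, rule exI[of _ b], rule exI[of _ a]) (use ab 2 in simp)
      ultimately show ?thesis using swap_values 2 by (simp add: g_def transpose_commute)
    qed
    ultimately show ?thesis using f g 2 by simp
  next
    case 3
    have "f i = g i" for i by (rule fg) (use 3 in auto)
    then show ?thesis using f g 3 by simp
  qed
qed

text \<open>This is the shadow on numbers of reduced words of the transition equations for Schubert
  polynomials; Little's bijection is a bijective proof of it. Here it follows by induction on the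
  length: removal of the first letter commutes with both sides up to the correction terms of
  \<open>cover_term_left_descents\<close>. In the difference of the two sides these terms contribute
  \<open>num_red \<sigma>\<close> once because the value \<open>\<sigma> k + 1\<close> occurs exactly once, left or right of \<open>k\<close>, and
  once with the opposite sign because of the value \<open>\<sigma> k - 1\<close>. Both values have to exist, and this
  is why the positions \<open>0\<close> and \<open>M + 1\<close>, which \<open>\<sigma>\<close> fixes, take part in the sums.\<close>

lemma transition:
  assumes "\<sigma> permutes {1..M}" "k \<in> {1..M}"
  shows "(\<Sum>j\<in>{k<..Suc M}. cover_term \<sigma> k j) = (\<Sum>j\<in>{..<k}. cover_term \<sigma> j k)"
  using assms(1)
proof (induction "len \<sigma>" arbitrary: \<sigma> rule: less_induct)
  case less
  have perm: "permutation \<sigma>" using less.prems by (auto simp: permutation_permutes)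
  have inj: "inj \<sigma>" using less.prems by (rule permutes_inj)
  let ?U = "\<lambda>\<tau>. \<Sum>j\<in>{k<..Suc M}. cover_term \<tau> k j"
  let ?L = "\<lambda>\<tau>. \<Sum>j\<in>{..<k}. cover_term \<tau> j k"
  let ?D = "left_descents \<sigma>"
  define below where "below j = (if \<sigma> k = Suc (\<sigma> j) then num_red \<sigma> else 0)" for j
  define above where "above j = (if \<sigma> j = Suc (\<sigma> k) then num_red \<sigma> else 0)" for j
  have IH: "?U (swap i \<circ> \<sigma>) = ?L (swap i \<circ> \<sigma>)" if i: "i \<in> ?D" for i
  proof (rule less.hyps)
    show "len (swap i \<circ> \<sigma>) < len \<sigma>" using perm i by (rule len_left_descent)
    obtain p q where pq: "q < p" "\<sigma> p = i" "\<sigma> q = Suc i"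
      using i by (auto simp: left_descents_def)
    have fixed: "\<sigma> x = x" if "x \<notin> {1..M}" for x using less.prems that by (rule permutes_not_in)
    have "p \<in> {1..M}"
    proof (rule ccontr)
      assume "p \<notin> {1..M}"
      then have p: "\<sigma> p = p" by (rule fixed)
      show False
      proof (cases "p = 0")
        case False
        then have "\<sigma> (Suc p) = Suc p" using \<open>p \<notin> {1..M}\<close> by (intro fixed) auto
        then have "\<sigma> q = \<sigma> (Suc p)" using p pq by simp
        then show False using inj pq by (simp add: inj_eq)
      qed (use pq in simp)
    qed
    then have i: "i \<in> {1..M}" using pq permutes_in_image[OF less.prems, of p] by simp
    have "i \<noteq> M"
    proof
      assume "i = M"
      then have "\<sigma> q = \<sigma> (Suc M)" using pq fixed[of "Suc M"] by simp
      then have "q = Suc M" using inj by (simp add: inj_eq)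
      then show False using \<open>p \<in> {1..M}\<close> pq by simp
    qed
    then have "i \<in> {1..M}" "Suc i \<in> {1..M}" using i by auto
    then show "swap i \<circ> \<sigma> permutes {1..M}"
      by (intro permutes_compose less.prems permutes_swap_id)
  qed
  have U: "?U \<sigma> + sum below {k<..Suc M} = (\<Sum>i\<in>?D. ?U (swap i \<circ> \<sigma>)) + sum above {k<..Suc M}"
  proof -
    have "?U \<sigma> + sum below {k<..Suc M} = (\<Sum>j\<in>{k<..Suc M}. cover_term \<sigma> k j + below j)"
      by (simp add: sum.distrib)
    also have "\<dots> = (\<Sum>j\<in>{k<..Suc M}. (\<Sum>i\<in>?D. cover_term (swap i \<circ> \<sigma>) k j) + above j)"
      unfolding below_def above_def
      by (intro sum.cong refl cover_term_left_descents perm) auto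
    also have "\<dots> = (\<Sum>i\<in>?D. ?U (swap i \<circ> \<sigma>)) + sum above {k<..Suc M}"
      by (simp add: sum.distrib sum.swap[of _ ?D])
    finally show ?thesis .
  qed
  have L: "?L \<sigma> + sum above {..<k} = (\<Sum>i\<in>?D. ?L (swap i \<circ> \<sigma>)) + sum below {..<k}"
  proof -
    have "?L \<sigma> + sum above {..<k} = (\<Sum>j\<in>{..<k}. cover_term \<sigma> j k + above j)"
      by (simp add: sum.distrib)
    also have "\<dots> = (\<Sum>j\<in>{..<k}. (\<Sum>i\<in>?D. cover_term (swap i \<circ> \<sigma>) j k) + below j)"
      unfolding below_def above_def
      by (intro sum.cong refl cover_term_left_descents perm) auto
    also have "\<dots> = (\<Sum>i\<in>?D. ?L (swap i \<circ> \<sigma>)) + sum below {..<k}"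
      by (simp add: sum.distrib sum.swap[of _ ?D])
    finally show ?thesis .
  qed
  (* below and above are each supported at a single position, which differs from k *)
  have total: "sum h {k<..Suc M} + sum h {..<k} = num_red \<sigma>"
    if "c \<le> Suc M" "c \<noteq> k" "h = (\<lambda>j. if j = c then num_red \<sigma> else 0)" for h c
    using that by (cases "c < k") auto
  have \<sigma>k: "\<sigma> k \<in> {1..M}" using permutes_in_image[OF less.prems, of k] assms(2) by simp
  obtain b where b: "\<sigma> b = \<sigma> k - 1" using less.prems permutes_surj by (metis surjD)
  obtain c where c: "\<sigma> c = Suc (\<sigma> k)" using less.prems permutes_surj by (metis surjD)
  have le: "j \<le> Suc M" if "\<sigma> j \<le> Suc M" for j
    using that permutes_not_in[OF less.prems, of j] by fastforce
  have "sum below {k<..Suc M} + sum below {..<k} = num_red \<sigma>"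
  proof (rule total)
    show "b \<le> Suc M" using le b \<sigma>k by auto
    show "b \<noteq> k" using b \<sigma>k by (intro notI) auto
    show "below = (\<lambda>j. if j = b then num_red \<sigma> else 0)"
    proof
      fix j
      have "\<sigma> k = Suc (\<sigma> j) \<longleftrightarrow> j = b" using inj_eq[OF inj, of j b] b \<sigma>k by auto
      then show "below j = (if j = b then num_red \<sigma> else 0)" by (simp add: below_def)
    qed
  qed
  moreover have "sum above {k<..Suc M} + sum above {..<k} = num_red \<sigma>"
  proof (rule total)
    show "c \<le> Suc M" using le c \<sigma>k by auto
    show "c \<noteq> k" using c by (intro notI) auto
    show "above = (\<lambda>j. if j = c then num_red \<sigma> else 0)"
    proof
      fix j
      have "\<sigma> j = Suc (\<sigma> k) \<longleftrightarrow> j = c" using inj_eq[OF inj, of j c] c by auto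
      then show "above j = (if j = c then num_red \<sigma> else 0)" by (simp add: above_def)
    qed
  qed
  moreover have "(\<Sum>i\<in>?D. ?U (swap i \<circ> \<sigma>)) = (\<Sum>i\<in>?D. ?L (swap i \<circ> \<sigma>))"
    using IH by (rule sum.cong[OF refl])
  ultimately show ?case using U L by linarith
qed

section \<open>Removing one box from a dominant permutation\<close>

text \<open>Dominant permutations are those whose Lehmer code is a partition, equivalently those
  avoiding 132. The fixed point \<open>0\<close> has to be left out as a first entry: it would complete every
  inversion to a 132 pattern. Positions beyond \<open>n\<close> carry larger values than all positions to
  their left, so no pattern ends there.\<close>

definition dominant :: "nat \<Rightarrow> (nat \<Rightarrow> nat) \<Rightarrow> bool" where
  "dominant n \<sigma> \<longleftrightarrow> \<sigma> permutes {1..n} \<and>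
     (\<forall>a b c. 0 < a \<and> a < b \<and> b < c \<longrightarrow> \<not> (\<sigma> a < \<sigma> c \<and> \<sigma> c < \<sigma> b))"

definition lehmer_code :: "(nat \<Rightarrow> nat) \<Rightarrow> nat \<Rightarrow> nat" where
  "lehmer_code \<sigma> i = card {j. i < j \<and> \<sigma> j < \<sigma> i}"

lemma finite_lehmer_code_set:
  fixes \<sigma> :: "nat \<Rightarrow> nat"
  assumes "permutation \<sigma>"
  shows "finite {j. i < j \<and> \<sigma> j < \<sigma> i}"
  by (rule finite_surj[OF finite_inversions[OF assms], of _ snd])
     (force simp: inversions_def image_iff)

text \<open>Position \<open>j\<close> carries the largest value below \<open>\<sigma> i\<close> among the entries to the right of \<open>i\<close>;
  exchanging the two entries lowers the Lehmer code at \<open>i\<close> by one and does not change it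
  elsewhere.\<close>

definition next_smaller :: "(nat \<Rightarrow> nat) \<Rightarrow> nat \<Rightarrow> nat \<Rightarrow> bool" where
  "next_smaller \<sigma> i j \<longleftrightarrow> i < j \<and> \<sigma> j < \<sigma> i \<and> (\<forall>c>i. \<sigma> c < \<sigma> i \<longrightarrow> \<sigma> c \<le> \<sigma> j)"

lemma ex_next_smaller:
  assumes "permutation \<sigma>" "\<sigma> (Suc i) < \<sigma> i"
  shows "\<exists>j. next_smaller \<sigma> i j"
proof -
  let ?S = "{j. i < j \<and> \<sigma> j < \<sigma> i}"
  have fin: "finite (\<sigma> ` ?S)" using finite_lehmer_code_set[OF assms(1)] by blast
  have "\<sigma> ` ?S \<noteq> {}" using assms(2) by blast
  then have "Max (\<sigma> ` ?S) \<in> \<sigma> ` ?S" using fin by (rule Max_in[rotated])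
  then obtain j where j: "j \<in> ?S" "\<sigma> j = Max (\<sigma> ` ?S)" by auto
  have "\<sigma> c \<le> \<sigma> j" if "i < c" "\<sigma> c < \<sigma> i" for c
    unfolding j(2) using fin that by (intro Max_ge) auto
  then show ?thesis using j(1) by (auto simp: next_smaller_def)
qed

context
  fixes n i j :: nat and \<sigma> \<sigma>' :: "nat \<Rightarrow> nat"
  assumes dom: "dominant n \<sigma>" and desc: "\<sigma> (Suc i) < \<sigma> i" and next_smaller: "next_smaller \<sigma> i j"
  defines "\<sigma>' \<equiv> \<sigma> \<circ> transpose i j"
begin

private lemma perm: "\<sigma> permutes {1..n}" and
  avoids: "\<lbrakk>0 < a; a < b; b < c; \<sigma> a < \<sigma> c; \<sigma> c < \<sigma> b\<rbrakk> \<Longrightarrow> False"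
  using dom unfolding dominant_def by blast+

private lemma inj: "\<sigma> a = \<sigma> b \<longleftrightarrow> a = b"
  using permutes_inj[OF perm] by (simp add: inj_eq)

private lemma ij: "i < j" "\<sigma> j < \<sigma> i" and
  gap: "\<lbrakk>i < c; c \<noteq> j; \<sigma> c < \<sigma> i\<rbrakk> \<Longrightarrow> \<sigma> c < \<sigma> j"
  using next_smaller inj[of c j] unfolding next_smaller_def by (auto simp: order_less_le)

private lemma fixed: "c \<notin> {1..n} \<Longrightarrow> \<sigma> c = c"
  using perm by (rule permutes_not_in)

private lemma zero: "\<sigma> 0 = 0"
  by (rule fixed) simp

private lemma i_pos: "0 < i"
  using desc zero by (cases i) auto

private lemma j_le: "j \<le> n"
proof (rule ccontr)
  assume "\<not> j \<le> n"
  then have "\<sigma> j = j" by (intro fixed) simp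
  then have "\<sigma> i > n" using ij \<open>\<not> j \<le> n\<close> by linarith
  then have "i \<notin> {1..n}" using permutes_in_image[OF perm, of i] by auto
  then have "\<sigma> i = i" by (rule fixed)
  then show False using ij \<open>\<sigma> j = j\<close> by simp
qed

private lemma Suc_i_below: "j \<noteq> Suc i \<Longrightarrow> \<sigma> (Suc i) < \<sigma> j"
  using gap[of "Suc i"] desc by simp

private lemma \<sigma>'_values: "\<sigma>' i = \<sigma> j" "\<sigma>' j = \<sigma> i" "c \<noteq> i \<Longrightarrow> c \<noteq> j \<Longrightarrow> \<sigma>' c = \<sigma> c"
  by (simp_all add: \<sigma>'_def)

private lemma perm': "\<sigma>' permutes {1..n}"
  unfolding \<sigma>'_def using i_pos j_le ij(1)
  by (intro permutes_compose[OF permutes_swap_id perm]) auto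

text \<open>Apart from their mutual order, the exchange affects the comparison of the two entries only
  with values strictly between \<open>\<sigma> j\<close> and \<open>\<sigma> i\<close>, and by the choice of \<open>j\<close> all of these stand to
  the left of \<open>i\<close>. In most cases a 132 pattern in the new word therefore comes from one in the
  old word, if necessary with \<open>i\<close> replaced by \<open>j\<close> or conversely. The exception is a pattern that
  uses an entry above \<open>\<sigma> i\<close> at a position between \<open>i\<close> and \<open>j\<close>. Because of the descent at \<open>i\<close>
  there is none: it would form a 132 pattern in the old word together with the entries at \<open>i + 1\<close>
  and \<open>j\<close>.\<close>

lemma dominant_next_smaller: "dominant n \<sigma>'"
  unfolding dominant_def
proof (intro conjI allI impI notI)
  show "\<sigma>' permutes {1..n}" by (rule perm')
next
  fix p q s
  assume "0 < p \<and> p < q \<and> q < s" and "\<sigma>' p < \<sigma>' s \<and> \<sigma>' s < \<sigma>' q"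
  then have p: "0 < p" and pq: "p < q" and qs: "q < s" and 132: "\<sigma>' p < \<sigma>' s" "\<sigma>' s < \<sigma>' q"
    by simp_all
  (* the large entry q, together with i + 1 and j, would form a 132 pattern *)
  have no_231: False if "i < q" "q < j" "\<sigma> i < \<sigma> q"
  proof -
    have "q \<noteq> Suc i" using that desc by auto
    then have "Suc i < q" "\<sigma> (Suc i) < \<sigma> j" using that Suc_i_below by auto
    then show False using avoids[of "Suc i" q j] that ij by simp
  qed
  consider "p = i" | "q = i" | "s = i" | "p \<noteq> i" "q \<noteq> i" "s \<noteq> i" by blast
  then show False
  proof cases
    case 1
    consider "q = j" | "s = j" | "q \<noteq> j" "s \<noteq> j" by blast
    then show False
    proof cases
      case 1
      then show False using \<open>p = i\<close> pq qs 132 gap[of s] by (simp add: \<sigma>'_values)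
    next
      case 2
      then show False using \<open>p = i\<close> pq qs 132 no_231 by (simp add: \<sigma>'_values)
    next
      case 3
      then have "\<sigma> j < \<sigma> s" "\<sigma> s < \<sigma> q" using \<open>p = i\<close> pq qs 132 by (simp_all add: \<sigma>'_values)
      moreover have "\<sigma> i < \<sigma> s"
        using gap[of s] inj[of s i] 3 \<open>p = i\<close> pq qs \<open>\<sigma> j < \<sigma> s\<close> by fastforce
      ultimately show False using avoids[of i q s] \<open>p = i\<close> pq qs i_pos by simp
    qed
  next
    case 2
    have "p \<noteq> j" "s \<noteq> j" using 2 pq qs ij 132 by (auto simp: \<sigma>'_values)
    then have "\<sigma> p < \<sigma> s" "\<sigma> s < \<sigma> i" using 2 pq qs 132 ij by (simp_all add: \<sigma>'_values)
    then show False using avoids[of p i s] 2 p pq qs by simp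
  next
    case 3
    then have "\<sigma> p < \<sigma> j" "\<sigma> j < \<sigma> q" using pq qs 132 ij by (simp_all add: \<sigma>'_values)
    then show False
      using avoids[of p q i] avoids[of p q j] 3 p pq qs ij inj[of i q] by linarith
  next
    case 4
    consider "p = j" | "q = j" | "s = j" | "p \<noteq> j" "q \<noteq> j" "s \<noteq> j" by blast
    then show False
    proof cases
      case 1
      then have "\<sigma> i < \<sigma> s" "\<sigma> s < \<sigma> q" using 4 pq qs 132 by (simp_all add: \<sigma>'_values)
      then show False using avoids[of j q s] 1 p pq qs ij by simp
    next
      case 2
      then have "\<sigma> p < \<sigma> s" "\<sigma> s < \<sigma> i" using 4 pq qs 132 by (simp_all add: \<sigma>'_values)
      then show False using avoids[of p j s] gap[of s] 2 p pq qs ij by simp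
    next
      case 3
      then have vals: "\<sigma> p < \<sigma> i" "\<sigma> i < \<sigma> q" using 4 pq qs 132 by (simp_all add: \<sigma>'_values)
      have "\<not> \<sigma> p < \<sigma> j" using avoids[of p q j] vals 3 p pq qs ij by auto
      then have "p < i" using gap[of p] vals 3 4 pq qs by fastforce
      moreover have "q < i" using no_231 vals 3 4 qs by fastforce
      ultimately show False using avoids[of p q i] vals p pq by simp
    next
      case 4
      then show False
        using avoids[of p q s] \<open>p \<noteq> i\<close> \<open>q \<noteq> i\<close> \<open>s \<noteq> i\<close> p pq qs 132 by (simp add: \<sigma>'_values)
    qed
  qed
qed

lemma lehmer_code_next_smaller_same: "lehmer_code \<sigma> i = Suc (lehmer_code \<sigma>' i)"
proof -
  let ?S = "{c. i < c \<and> \<sigma> c < \<sigma> i}"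
  have "\<sigma>' c < \<sigma>' i \<longleftrightarrow> \<sigma> c < \<sigma> i \<and> c \<noteq> j" if "i < c" for c
    using that gap[of c] ij by (cases "c = j") (auto simp: \<sigma>'_values)
  then have "{c. i < c \<and> \<sigma>' c < \<sigma>' i} = ?S - {j}" by blast
  moreover have "j \<in> ?S" using ij by simp
  moreover have "finite ?S"
    using perm by (intro finite_lehmer_code_set) (auto simp: permutation_permutes)
  ultimately show ?thesis unfolding lehmer_code_def using card.remove[of ?S j] by presburger
qed

text \<open>For \<open>k\<close> left of \<open>i\<close> the entries to the right of \<open>k\<close> are merely permuted. No entry to the
  right of \<open>i\<close> lies strictly between \<open>\<sigma> j\<close> and \<open>\<sigma> i\<close>, so for \<open>k\<close> right of \<open>i\<close> the exchange does
  not affect the comparisons that count.\<close>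

lemma lehmer_code_next_smaller_other:
  assumes "k \<noteq> i"
  shows "lehmer_code \<sigma>' k = lehmer_code \<sigma> k"
proof (cases "k < i")
  case True
  have "{c. k < c \<and> \<sigma>' c < \<sigma>' k} = transpose i j ` {c. k < c \<and> \<sigma> c < \<sigma> k}"
  proof (rule set_eqI)
    fix c
    have "c \<in> transpose i j ` {c. k < c \<and> \<sigma> c < \<sigma> k} \<longleftrightarrow>
        transpose i j c \<in> {c. k < c \<and> \<sigma> c < \<sigma> k}"
      by (metis (no_types, lifting) image_iff transpose_involutory)
    also have "\<dots> \<longleftrightarrow> c \<in> {c. k < c \<and> \<sigma>' c < \<sigma>' k}"
      using True ij(1) by (auto simp: \<sigma>'_def transpose_def)
    finally show "c \<in> {c. k < c \<and> \<sigma>' c < \<sigma>' k} \<longleftrightarrow>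
        c \<in> transpose i j ` {c. k < c \<and> \<sigma> c < \<sigma> k}" ..
  qed
  then show ?thesis unfolding lehmer_code_def by (simp add: card_image)
next
  case False
  then have k: "i < k" using assms by simp
  have "\<sigma>' c < \<sigma>' k \<longleftrightarrow> \<sigma> c < \<sigma> k" if "k < c" for c
  proof -
    have *: "\<sigma> d < \<sigma> i \<longleftrightarrow> \<sigma> d < \<sigma> j" "\<sigma> i < \<sigma> d \<longleftrightarrow> \<sigma> j < \<sigma> d"
      if "i < d" "d \<noteq> j" for d
      using that gap[of d] inj[of d i] ij by (cases "\<sigma> d < \<sigma> i"; simp; linarith)+
    consider "k = j" | "c = j" "k \<noteq> j" | "k \<noteq> j" "c \<noteq> j" by blast
    then show ?thesis
      using k that by cases (simp_all add: \<sigma>'_values *)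
  qed
  then show ?thesis unfolding lehmer_code_def by meson
qed

text \<open>Removing the last letter \<open>i\<close> leads to \<open>\<sigma> \<circ> swap i\<close>, which in general is no longer dominant.
  If \<open>j \<noteq> i + 1\<close>, then \<open>\<sigma> \<circ> swap i\<close> and the dominant \<open>\<sigma>'\<close> are both covers of \<open>u = \<sigma>' \<circ> swap i\<close>,
  and 132-avoidance leaves no others in the transition identity at position \<open>k = i + 1\<close>: on its
  right the exchange of \<open>k\<close> and \<open>j\<close> is the only cover and yields \<open>\<sigma> \<circ> swap i\<close>, on its left the
  exchange of \<open>i\<close> and \<open>k\<close> is the only cover and yields \<open>\<sigma>'\<close>. If \<open>j = i + 1\<close>, the two permutations
  coincide.\<close>

lemma num_red_next_smaller: "num_red (\<sigma> \<circ> swap i) = num_red \<sigma>'"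
proof (cases "j = Suc i")
  case False
  define k where "k = Suc i"
  have ikj: "i < k" "k < j" using False ij by (simp_all add: k_def)
  define u where "u = \<sigma>' \<circ> swap i"
  have u: "u i = \<sigma> k" "u k = \<sigma> j" "u j = \<sigma> i" "\<And>c. c \<noteq> i \<Longrightarrow> c \<noteq> k \<Longrightarrow> c \<noteq> j \<Longrightarrow> u c = \<sigma> c"
    using ikj by (auto simp: u_def \<sigma>'_def k_def transpose_def)
  have ykz: "\<sigma> k < \<sigma> j" using Suc_i_below False by (simp add: k_def)
  have perm_u: "u permutes {1..n}"
    unfolding u_def using i_pos j_le ikj
    by (intro permutes_compose[OF permutes_swap_id perm']) (auto simp: k_def)
  (* an entry above x = \<sigma> i beyond j is blocked by x itself, which u has at j;
     one before j would form a 132 pattern with the entries at k and j *)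
  have right: "bruhat_cover u k c \<longleftrightarrow> c = j" for c
  proof
    assume cov: "bruhat_cover u k c"
    show "c = j"
    proof (rule ccontr)
      assume "c \<noteq> j"
      have c: "k < c" "\<sigma> j < \<sigma> c" and betw: "\<And>d. k < d \<Longrightarrow> d < c \<Longrightarrow> \<not> (\<sigma> j < u d \<and> u d < \<sigma> c)"
        using cov ikj u(4)[of c] \<open>c \<noteq> j\<close> u(2) by (auto simp: bruhat_cover_def)
      have "\<sigma> i < \<sigma> c" using c gap[of c] inj[of c i] \<open>c \<noteq> j\<close> ikj by fastforce
      show False
      proof (cases "c < j")
        case True
        then show False using avoids[of k c j] ykz c ikj by simp
      next
        case False
        then show False using betw[of j] u(3) ij \<open>\<sigma> i < \<sigma> c\<close> \<open>c \<noteq> j\<close> ikj by simp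
      qed
    qed
  next
    assume "c = j"
    have "\<not> (\<sigma> j < u d \<and> u d < \<sigma> i)" if "k < d" "d < j" for d
      using that gap[of d] u(4)[of d] ikj by auto
    then show "bruhat_cover u k c"
      using ikj u ij \<open>c = j\<close> by (auto simp: bruhat_cover_def)
  qed
  (* an entry left of i with value between \<sigma> k and \<sigma> j would form a 132 pattern with i and j *)
  have left: "bruhat_cover u c k \<longleftrightarrow> c = i" for c
  proof
    assume cov: "bruhat_cover u c k"
    show "c = i"
    proof (rule ccontr)
      assume "c \<noteq> i"
      then have c: "c < i" using cov by (auto simp: bruhat_cover_def k_def)
      then have uc: "u c = \<sigma> c" using ikj u by auto
      then have "\<sigma> c < \<sigma> j" "\<not> (\<sigma> c < \<sigma> k \<and> \<sigma> k < \<sigma> j)"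
        using cov c ikj u unfolding bruhat_cover_def by metis+
      then have "\<sigma> k < \<sigma> c" using ykz inj[of c k] c ikj by fastforce
      then have "0 < c" using zero by (cases c) auto
      then show False using avoids[of c i j] \<open>\<sigma> c < \<sigma> j\<close> c ij by simp
    qed
  next
    assume "c = i"
    then show "bruhat_cover u c k" using u ykz by (auto simp: bruhat_cover_def k_def)
  qed
  have "(\<Sum>c\<in>{k<..Suc n}. cover_term u k c) = cover_term u k j"
    using ikj j_le by (simp add: cover_term_def right if_distrib cong: if_cong)
  moreover have "(\<Sum>c\<in>{..<k}. cover_term u c k) = cover_term u i k"
    using ikj by (simp add: cover_term_def left if_distrib cong: if_cong)
  moreover have "k \<in> {1..n}" using ikj j_le by (simp add: k_def)
  ultimately have "cover_term u k j = cover_term u i k"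
    using transition[OF perm_u] by metis
  moreover have "u \<circ> transpose k j = \<sigma> \<circ> swap i"
    using ikj by (auto simp: u_def \<sigma>'_def k_def fun_eq_iff transpose_def)
  moreover have "u \<circ> transpose i k = \<sigma>'"
    by (simp add: u_def k_def comp_assoc)
  ultimately show ?thesis by (simp add: cover_term_def left right)
qed (simp add: \<sigma>'_def)

end

section \<open>Standard fillings of finite order ideals\<close>

definition order_ideal :: "(nat \<times> nat) set \<Rightarrow> bool" where
  "order_ideal Y \<longleftrightarrow> (\<forall>i j i' j'. (i, j) \<in> Y \<and> i' \<le> i \<and> j' \<le> j \<longrightarrow> (i', j') \<in> Y)"

lemma order_idealD: "order_ideal Y \<Longrightarrow> (i, j) \<in> Y \<Longrightarrow> i' \<le> i \<Longrightarrow> j' \<le> j \<Longrightarrow> (i', j') \<in> Y"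
  unfolding order_ideal_def by blast

text \<open>The same conditions as for standard Young tableaux of a partition, for an arbitrary set of
  cells, so that removing a cell does not require recomputing a list of parts.\<close>

definition tableaux :: "(nat \<times> nat) set \<Rightarrow> (nat \<times> nat \<Rightarrow> nat) set" where
  "tableaux Y = {T \<in> extensional Y. bij_betw T Y {1..card Y} \<and>
     (\<forall>i j k. j < k \<and> (i, k) \<in> Y \<longrightarrow> T (i, j) < T (i, k)) \<and>
     (\<forall>i j k. i < k \<and> (k, j) \<in> Y \<longrightarrow> T (i, j) < T (k, j))}"

lemma tableauxD:
  assumes "T \<in> tableaux Y"
  shows "T \<in> extensional Y" "bij_betw T Y {1..card Y}"
    and "\<And>i j k. j < k \<Longrightarrow> (i, k) \<in> Y \<Longrightarrow> T (i, j) < T (i, k)"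
    and "\<And>i j k. i < k \<Longrightarrow> (k, j) \<in> Y \<Longrightarrow> T (i, j) < T (k, j)"
  using assms unfolding tableaux_def by blast+

lemma tableauxI:
  assumes "T \<in> extensional Y" "bij_betw T Y {1..card Y}"
    and "\<And>i j k. j < k \<Longrightarrow> (i, k) \<in> Y \<Longrightarrow> T (i, j) < T (i, k)"
    and "\<And>i j k. i < k \<Longrightarrow> (k, j) \<in> Y \<Longrightarrow> T (i, j) < T (k, j)"
  shows "T \<in> tableaux Y"
  using assms unfolding tableaux_def by blast

definition corners :: "(nat \<times> nat) set \<Rightarrow> (nat \<times> nat) set" where
  "corners Y = {(i, j) \<in> Y. (Suc i, j) \<notin> Y \<and> (i, Suc j) \<notin> Y}"

lemma corner_not_less:
  assumes "order_ideal Y" "(a, b) \<in> corners Y" "(i, j) \<in> Y" "a \<le> i" "b \<le> j"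
  shows "(i, j) = (a, b)"
proof (rule ccontr)
  assume "(i, j) \<noteq> (a, b)"
  then have "Suc a \<le> i \<or> Suc b \<le> j" using assms(4,5) by auto
  then show False
    using assms order_idealD[OF assms(1,3), of "Suc a" b] order_idealD[OF assms(1,3), of a "Suc b"]
    by (auto simp: corners_def)
qed

lemma finite_tableaux:
  assumes "finite Y"
  shows "finite (tableaux Y)"
proof (rule finite_subset)
  show "tableaux Y \<subseteq> Y \<rightarrow>\<^sub>E {1..card Y}"
    by (auto simp: tableaux_def PiE_def bij_betw_def)
  show "finite (Y \<rightarrow>\<^sub>E {1..card Y})"
    using assms by (intro finite_PiE) auto
qed

lemma tableaux_restrict:
  assumes fin: "finite Y" and ideal: "order_ideal Y" and c: "c \<in> corners Y"
    and T: "T \<in> tableaux Y" "T c = card Y"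
  shows "restrict T (Y - {c}) \<in> tableaux (Y - {c})"
proof -
  have cY: "c \<in> Y" using c by (auto simp: corners_def)
  have bij: "bij_betw T Y {1..card Y}" using T(1) by (rule tableauxD)
  have "bij_betw T (Y - {c}) ({1..card Y} - {card Y})"
  proof (rule bij_betw_DiffI[OF bij])
    show "bij_betw T {c} {card Y}" using T(2) by (simp add: bij_betw_def)
    show "{c} \<subseteq> Y" using cY by simp
    have "0 < card Y" using cY fin by (auto simp: card_gt_0_iff)
    then show "{card Y} \<subseteq> {1..card Y}" by simp
  qed
  moreover have "{1..card Y} - {card Y} = {1..card (Y - {c})}"
    using cY fin by (auto simp: card_Diff_singleton)
  ultimately have "bij_betw T (Y - {c}) {1..card (Y - {c})}" by simp
  then have "bij_betw (restrict T (Y - {c})) (Y - {c}) {1..card (Y - {c})}"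
    by (subst bij_betw_cong[of _ _ T]) auto
  have down: "(i, j) \<in> Y - {c}" if "(i', j') \<in> Y - {c}" "i \<le> i'" "j \<le> j'" for i j i' j'
    using that ideal c corner_not_less[OF ideal, of i j i' j'] order_idealD[OF ideal, of i' j' i j]
    by auto
  show ?thesis
  proof (rule tableauxI)
    show "bij_betw (restrict T (Y - {c})) (Y - {c}) {1..card (Y - {c})}" by fact
  next
    fix i j k :: nat assume "j < k" "(i, k) \<in> Y - {c}"
    then show "restrict T (Y - {c}) (i, j) < restrict T (Y - {c}) (i, k)"
      using down[of i k i j] tableauxD(3)[OF T(1), of j k i] by simp
  next
    fix i j k :: nat assume "i < k" "(k, j) \<in> Y - {c}"
    then show "restrict T (Y - {c}) (i, j) < restrict T (Y - {c}) (k, j)"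
      using down[of k j i j] tableauxD(4)[OF T(1), of i k j] by simp
  qed simp
qed

lemma tableaux_extend:
  assumes fin: "finite Y" and ideal: "order_ideal Y" and c: "c \<in> corners Y"
    and T: "T \<in> tableaux (Y - {c})"
  shows "T(c := card Y) \<in> tableaux Y"
proof -
  let ?T = "T(c := card Y)"
  have cY: "c \<in> Y" using c by (auto simp: corners_def)
  have bij: "bij_betw T (Y - {c}) {1..card (Y - {c})}" using T by (rule tableauxD)
  have card: "card Y = Suc (card (Y - {c}))" using fin cY by (rule card.remove)
  have "bij_betw ?T (Y - {c}) {1..card (Y - {c})}"
    using bij by (subst bij_betw_cong[of _ _ T]) auto
  then have "bij_betw ?T ((Y - {c}) \<union> {c}) ({1..card (Y - {c})} \<union> {?T c})"
    using card by (intro notIn_Un_bij_betw) auto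
  moreover have "(Y - {c}) \<union> {c} = Y" "{1..card (Y - {c})} \<union> {?T c} = {1..card Y}"
    using cY card by auto
  ultimately have "bij_betw ?T Y {1..card Y}" by metis
  have less: "?T (i, j) < ?T (i', j')"
    if "(i', j') \<in> Y" "i \<le> i'" "j \<le> j'" "(i, j) \<noteq> (i', j')"
      "(i', j') \<noteq> c \<Longrightarrow> T (i, j) < T (i', j')" for i j i' j'
  proof -
    have "(i, j) \<in> Y" using ideal that(1-3) by (rule order_idealD)
    have ne: "(i, j) \<noteq> c"
      using corner_not_less[OF ideal, of i j i' j'] c that(1-4) by auto
    then have "T (i, j) \<in> {1..card (Y - {c})}"
      using bij_betwE[OF bij] \<open>(i, j) \<in> Y\<close> by blast
    then have "T (i, j) < card Y" using card by simp
    then show ?thesis using that(5) ne by (cases "(i', j') = c") auto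
  qed
  show ?thesis
  proof (rule tableauxI)
    show "?T \<in> extensional Y"
      using tableauxD(1)[OF T] cY by (auto simp: extensional_def)
    show "bij_betw ?T Y {1..card Y}" by fact
    show "?T (i, j) < ?T (i, k)" if "j < k" "(i, k) \<in> Y" for i j k
      using that tableauxD(3)[OF T, of j k i] by (intro less) auto
    show "?T (i, j) < ?T (k, j)" if "i < k" "(k, j) \<in> Y" for i j k
      using that tableauxD(4)[OF T, of i k j] by (intro less) auto
  qed
qed

text \<open>The largest entry of a tableau sits in a corner, and deleting it leaves a tableau on the
  remaining cells.\<close>

lemma card_tableaux_eq_sum_corners:
  assumes fin: "finite Y" and ideal: "order_ideal Y" and ne: "Y \<noteq> {}"
  shows "card (tableaux Y) = (\<Sum>c\<in>corners Y. card (tableaux (Y - {c})))"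
proof -
  define A where "A c = {T \<in> tableaux Y. T c = card Y}" for c
  have fin_c: "finite (corners Y)"
    using fin by (rule finite_subset[rotated]) (auto simp: corners_def)
  have cov: "tableaux Y = (\<Union>c\<in>corners Y. A c)"
  proof
    show "tableaux Y \<subseteq> (\<Union>c\<in>corners Y. A c)"
    proof
      fix T assume T: "T \<in> tableaux Y"
      have bij: "bij_betw T Y {1..card Y}" using T by (rule tableauxD)
      have "card Y \<in> T ` Y" using bij fin ne by (auto simp: bij_betw_def Suc_le_eq card_gt_0_iff)
      then obtain i j where c: "(i, j) \<in> Y" "T (i, j) = card Y" by auto
      have le: "T d \<le> card Y" if "d \<in> Y" for d using bij that by (auto simp: bij_betw_def)
      have "(Suc i, j) \<notin> Y" "(i, Suc j) \<notin> Y"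
        using tableauxD(3)[OF T, of j "Suc j" i] tableauxD(4)[OF T, of i "Suc i" j]
          c le[of "(Suc i, j)"] le[of "(i, Suc j)"] by fastforce+
      then show "T \<in> (\<Union>c\<in>corners Y. A c)" using T c by (auto simp: corners_def A_def)
    qed
  qed (auto simp: A_def)
  have "card (tableaux Y) = (\<Sum>c\<in>corners Y. card (A c))"
    unfolding cov
  proof (rule card_UN_disjoint[OF fin_c])
    show "\<forall>c\<in>corners Y. finite (A c)"
      using finite_tableaux[OF fin] by (auto simp: A_def)
    show "\<forall>c\<in>corners Y. \<forall>d\<in>corners Y. c \<noteq> d \<longrightarrow> A c \<inter> A d = {}"
    proof (intro ballI impI)
      fix c d assume cd: "c \<in> corners Y" "d \<in> corners Y" "c \<noteq> d"
      have "c \<in> Y" "d \<in> Y" using cd by (auto simp: corners_def)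
      then have ne: "T c \<noteq> T d" if "T \<in> tableaux Y" for T
        using inj_onD[OF bij_betw_imp_inj_on[OF tableauxD(2)[OF that]], of c d] cd(3) by blast
      show "A c \<inter> A d = {}"
      proof (rule equals0I)
        fix T assume "T \<in> A c \<inter> A d"
        then have "T \<in> tableaux Y" "T c = T d" by (simp_all add: A_def)
        then show False using ne[of T] by blast
      qed
    qed
  qed
  also have "\<dots> = (\<Sum>c\<in>corners Y. card (tableaux (Y - {c})))"
  proof (rule sum.cong[OF refl])
    fix c assume c: "c \<in> corners Y"
    then have cY: "c \<in> Y" by (auto simp: corners_def)
    have "bij_betw (\<lambda>T. restrict T (Y - {c})) (A c) (tableaux (Y - {c}))"
    proof (rule bij_betwI[where g = "\<lambda>T. T(c := card Y)"])
      show "(\<lambda>T. restrict T (Y - {c})) \<in> A c \<rightarrow> tableaux (Y - {c})"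
        using tableaux_restrict[OF fin ideal c] by (auto simp: A_def)
      show "(\<lambda>T. T(c := card Y)) \<in> tableaux (Y - {c}) \<rightarrow> A c"
        using tableaux_extend[OF fin ideal c] by (auto simp: A_def)
      show "(restrict T (Y - {c}))(c := card Y) = T" if "T \<in> A c" for T
        using that by (auto simp: A_def tableaux_def extensional_def fun_eq_iff)
      show "restrict (T(c := card Y)) (Y - {c}) = T" if "T \<in> tableaux (Y - {c})" for T
        using that by (auto simp: tableaux_def extensional_def fun_eq_iff)
    qed
    then show "card (A c) = card (tableaux (Y - {c}))" by (rule bij_betw_same_card)
  qed
  finally show ?thesis .
qed

lemma card_tableaux_empty: "card (tableaux {}) = 1"
proof -
  have "tableaux {} = {\<lambda>_. undefined}" by (auto simp: tableaux_def bij_betw_def)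
  then show ?thesis by simp
qed

section \<open>Diagrams of dominant permutations\<close>

text \<open>Row \<open>i\<close>, counted from \<open>0\<close>, belongs to position \<open>i + 1\<close>.\<close>

definition diagram :: "(nat \<Rightarrow> nat) \<Rightarrow> (nat \<times> nat) set" where
  "diagram \<sigma> = {(i, j). j < lehmer_code \<sigma> (Suc i)}"

lemma dominant_permutation: "dominant n \<sigma> \<Longrightarrow> permutation \<sigma>"
  by (auto simp: dominant_def permutation_permutes)

text \<open>Read on values, the code counts the smaller values not yet used to the left of \<open>p\<close>. This is
  what makes it possible to recover a permutation from its code from left to right.\<close>

lemma lehmer_code_eq_values:
  assumes "bij \<sigma>"
  shows "lehmer_code \<sigma> p = card ({..<\<sigma> p} - \<sigma> ` {..<p})"
proof -
  have inj: "\<sigma> a = \<sigma> b \<longleftrightarrow> a = b" for a b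
    using assms by (simp add: bij_is_inj inj_eq)
  have "bij_betw \<sigma> {j. p < j \<and> \<sigma> j < \<sigma> p} ({..<\<sigma> p} - \<sigma> ` {..<p})"
  proof (rule bij_betw_imageI)
    show "inj_on \<sigma> {j. p < j \<and> \<sigma> j < \<sigma> p}" by (simp add: inj_on_def inj)
    show "\<sigma> ` {j. p < j \<and> \<sigma> j < \<sigma> p} = {..<\<sigma> p} - \<sigma> ` {..<p}" (is "?l = ?r")
    proof
      show "?l \<subseteq> ?r" by (auto simp: inj)
      show "?r \<subseteq> ?l"
      proof
        fix v assume v: "v \<in> ?r"
        obtain j where j: "v = \<sigma> j" using assms by (metis bij_pointE)
        then have "\<not> j < p" "j \<noteq> p" using v by auto
        then show "v \<in> ?l" using v j by auto
      qed
    qed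
  qed
  then show ?thesis unfolding lehmer_code_def by (rule bij_betw_same_card)
qed

lemma lehmer_code_less_code:
  assumes "bij \<sigma>" "bij \<tau>" "\<And>q. q < p \<Longrightarrow> \<sigma> q = \<tau> q" "\<sigma> p < \<tau> p"
  shows "lehmer_code \<sigma> p < lehmer_code \<tau> p"
proof -
  have im: "\<sigma> ` {..<p} = \<tau> ` {..<p}" using assms(3) by (intro image_cong) auto
  have "\<sigma> p \<notin> \<sigma> ` {..<p}" using assms(1) by (auto simp: bij_is_inj inj_eq)
  then show ?thesis
    unfolding lehmer_code_eq_values[OF assms(1)] lehmer_code_eq_values[OF assms(2)]
    using assms(4) by (intro psubset_card_mono) (auto simp: im)
qed

lemma lehmer_code_inject:
  assumes "bij \<sigma>" "bij \<tau>" "\<And>i. lehmer_code \<sigma> i = lehmer_code \<tau> i"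
  shows "\<sigma> = \<tau>"
proof
  show "\<sigma> p = \<tau> p" for p
  proof (induction p rule: less_induct)
    case (less p)
    then show ?case
      using lehmer_code_less_code[OF assms(1,2), of p]
        lehmer_code_less_code[OF assms(2,1), of p] assms(3)
      by (metis less_irrefl nat_neq_iff)
  qed
qed

lemma inj_on_diagram: "inj_on diagram {\<sigma>. \<sigma> permutes {1..n}}"
proof (rule inj_onI)
  fix \<sigma> \<tau> assume "\<sigma> \<in> {\<sigma>. \<sigma> permutes {1..n}}" "\<tau> \<in> {\<sigma>. \<sigma> permutes {1..n}}"
  then have perm: "\<sigma> permutes {1..n}" "\<tau> permutes {1..n}" by simp_all
  assume eq: "diagram \<sigma> = diagram \<tau>"
  show "\<sigma> = \<tau>"
  proof (rule lehmer_code_inject)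
    show "bij \<sigma>" "bij \<tau>" using perm by (simp_all add: permutes_bij)
    fix i
    show "lehmer_code \<sigma> i = lehmer_code \<tau> i"
    proof (cases i)
      case 0
      then show ?thesis
        using permutes_not_in[OF perm(1), of 0] permutes_not_in[OF perm(2), of 0]
        by (simp add: lehmer_code_def)
    next
      case (Suc k)
      have "j < lehmer_code \<sigma> i \<longleftrightarrow> j < lehmer_code \<tau> i" for j
        using eq Suc by (auto simp: diagram_def set_eq_iff)
      then show ?thesis by (metis linorder_neqE_nat less_irrefl)
    qed
  qed
qed

lemma diagram_id: "diagram id = {}"
proof -
  have "{j. i < j \<and> id j < id i} = {}" for i :: nat by auto
  then have "lehmer_code id i = 0" for i unfolding lehmer_code_def by (metis card.empty)
  then show ?thesis by (simp add: diagram_def)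
qed

text \<open>By 132-avoidance an entry after position \<open>i + 1\<close> below \<open>\<sigma> (i + 1)\<close> is also below \<open>\<sigma> i\<close>.\<close>

lemma lehmer_code_Suc_less_iff:
  assumes "dominant n \<sigma>" "0 < i"
  shows "lehmer_code \<sigma> (Suc i) < lehmer_code \<sigma> i \<longleftrightarrow> \<sigma> (Suc i) < \<sigma> i"
    and "lehmer_code \<sigma> (Suc i) \<le> lehmer_code \<sigma> i"
proof -
  let ?S = "\<lambda>i. {j. i < j \<and> \<sigma> j < \<sigma> i}"
  have fin: "finite (?S i)" for i
    using assms by (intro finite_lehmer_code_set dominant_permutation)
  have ne: "\<sigma> i \<noteq> \<sigma> (Suc i)"
    using assms by (metis dominant_permutation bij_is_inj inj_eq n_not_Suc_n permutation)
  have sub: "?S (Suc i) \<subseteq> ?S i"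
  proof
    fix j assume j: "j \<in> ?S (Suc i)"
    then have "\<not> \<sigma> i < \<sigma> j" using assms unfolding dominant_def
      by (metis (mono_tags) lessI mem_Collect_eq)
    moreover have "\<sigma> i \<noteq> \<sigma> j"
      using j assms by (metis (mono_tags) dominant_permutation bij_is_inj inj_eq
        permutation Suc_lessD less_irrefl mem_Collect_eq)
    ultimately show "j \<in> ?S i" using j by auto
  qed
  then show "lehmer_code \<sigma> (Suc i) \<le> lehmer_code \<sigma> i" unfolding lehmer_code_def using fin
    by (intro card_mono)
  show "lehmer_code \<sigma> (Suc i) < lehmer_code \<sigma> i \<longleftrightarrow> \<sigma> (Suc i) < \<sigma> i"
  proof
    assume desc: "\<sigma> (Suc i) < \<sigma> i"
    then have "Suc i \<in> ?S i" "Suc i \<notin> ?S (Suc i)" by auto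
    then have "?S (Suc i) \<subset> ?S i" using sub by blast
    then show "lehmer_code \<sigma> (Suc i) < lehmer_code \<sigma> i" unfolding lehmer_code_def using fin
      by (intro psubset_card_mono)
  next
    assume less: "lehmer_code \<sigma> (Suc i) < lehmer_code \<sigma> i"
    show "\<sigma> (Suc i) < \<sigma> i"
    proof (rule ccontr)
      assume "\<not> \<sigma> (Suc i) < \<sigma> i"
      then have "\<sigma> i < \<sigma> (Suc i)" using ne by simp
      then have "?S i \<subseteq> ?S (Suc i)" by (auto intro: Suc_lessI)
      then have "lehmer_code \<sigma> i \<le> lehmer_code \<sigma> (Suc i)" unfolding lehmer_code_def using fin
        by (intro card_mono)
      then show False using less by simp
    qed
  qed
qed

lemma lehmer_code_antimono:
  assumes "dominant n \<sigma>" "0 < i" "i \<le> k"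
  shows "lehmer_code \<sigma> k \<le> lehmer_code \<sigma> i"
  using assms(3)
proof (induction k rule: dec_induct)
  case (step k)
  then show ?case using lehmer_code_Suc_less_iff(2)[OF assms(1), of k] assms(2) by linarith
qed simp

lemma order_ideal_diagram:
  assumes "dominant n \<sigma>"
  shows "order_ideal (diagram \<sigma>)"
  unfolding order_ideal_def
proof (intro allI impI)
  fix i j i' j' assume "(i, j) \<in> diagram \<sigma> \<and> i' \<le> i \<and> j' \<le> j"
  then show "(i', j') \<in> diagram \<sigma>"
    using lehmer_code_antimono[OF assms, of "Suc i'" "Suc i"] by (simp add: diagram_def)
qed

lemma lehmer_code_le:
  assumes "\<sigma> permutes {1..n}" "i \<le> n"
  shows "lehmer_code \<sigma> i \<le> n - i"
proof -
  have "{j. i < j \<and> \<sigma> j < \<sigma> i} \<subseteq> {i<..n}"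
  proof clarsimp
    fix j assume j: "i < j" "\<sigma> j < \<sigma> i"
    show "j \<le> n"
    proof (rule ccontr)
      assume "\<not> j \<le> n"
      then have "\<sigma> j = j" using permutes_not_in[OF assms(1), of j] by simp
      moreover have "\<sigma> i \<le> n"
        using permutes_in_image[OF assms(1), of i] permutes_not_in[OF assms(1), of i] assms(2)
        by (cases "i \<in> {1..n}") auto
      ultimately show False using j \<open>\<not> j \<le> n\<close> by simp
    qed
  qed
  then have "lehmer_code \<sigma> i \<le> card {i<..n}" unfolding lehmer_code_def by (intro card_mono) auto
  then show ?thesis by simp
qed

lemma young_diagram_staircase: "young_diagram (staircase n) = {(i, j). Suc (i + j) < n}"
  by (auto simp: young_diagram_def staircase_def rev_nth)

lemma finite_young_diagram: "finite (young_diagram l)"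
proof -
  have "young_diagram l = (SIGMA i:{..<length l}. {..<l ! i})"
    by (auto simp: young_diagram_def)
  then show ?thesis by simp
qed

lemma diagram_subset_staircase:
  assumes "\<sigma> permutes {1..n}"
  shows "diagram \<sigma> \<subseteq> young_diagram (staircase n)"
proof clarify
  fix i j assume "(i, j) \<in> diagram \<sigma>"
  then have j: "j < lehmer_code \<sigma> (Suc i)" by (simp add: diagram_def)
  show "(i, j) \<in> young_diagram (staircase n)"
  proof (cases "Suc i \<le> n")
    case True
    then show ?thesis using j lehmer_code_le[OF assms True] by (simp add: young_diagram_staircase)
  next
    case False
    have "\<sigma> k = k" if "n < k" for k using permutes_not_in[OF assms, of k] that by simp
    then have "{k. Suc i < k \<and> \<sigma> k < \<sigma> (Suc i)} = {}" using False by auto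
    then have "lehmer_code \<sigma> (Suc i) = 0" unfolding lehmer_code_def by (metis card.empty)
    then show ?thesis using j by simp
  qed
qed

lemma finite_diagram: "\<sigma> permutes {1..n} \<Longrightarrow> finite (diagram \<sigma>)"
  using diagram_subset_staircase finite_young_diagram finite_subset by blast

lemma descent_pos: "\<sigma> permutes {1..n} \<Longrightarrow> \<sigma> (Suc i) < \<sigma> i \<Longrightarrow> 0 < i"
  using permutes_not_in[of \<sigma> "{1..n}" 0] by (cases i) auto

lemma corners_diagram:
  assumes dom: "dominant n \<sigma>"
  shows "corners (diagram \<sigma>) = (\<lambda>i. (i - 1, lehmer_code \<sigma> i - 1)) ` {i. \<sigma> (Suc i) < \<sigma> i}"
proof -
  have perm: "\<sigma> permutes {1..n}" using dom by (simp add: dominant_def)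
  have "(i, j) \<in> corners (diagram \<sigma>) \<longleftrightarrow>
      \<sigma> (Suc (Suc i)) < \<sigma> (Suc i) \<and> lehmer_code \<sigma> (Suc i) = Suc j" for i j
    using lehmer_code_Suc_less_iff[OF dom, of "Suc i"] by (auto simp: corners_def diagram_def)
  moreover have "(i, j) \<in> (\<lambda>i. (i - 1, lehmer_code \<sigma> i - 1)) ` {i. \<sigma> (Suc i) < \<sigma> i} \<longleftrightarrow>
      \<sigma> (Suc (Suc i)) < \<sigma> (Suc i) \<and> lehmer_code \<sigma> (Suc i) = Suc j" for i j
  proof
    assume "(i, j) \<in> (\<lambda>i. (i - 1, lehmer_code \<sigma> i - 1)) ` {i. \<sigma> (Suc i) < \<sigma> i}"
    then obtain k where k: "\<sigma> (Suc k) < \<sigma> k" "i = k - 1" "j = lehmer_code \<sigma> k - 1" by auto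
    have "0 < k" using descent_pos[OF perm k(1)] .
    then show "\<sigma> (Suc (Suc i)) < \<sigma> (Suc i) \<and> lehmer_code \<sigma> (Suc i) = Suc j"
      using k lehmer_code_Suc_less_iff(1)[OF dom, of k] by simp
  next
    assume "\<sigma> (Suc (Suc i)) < \<sigma> (Suc i) \<and> lehmer_code \<sigma> (Suc i) = Suc j"
    then show "(i, j) \<in> (\<lambda>i. (i - 1, lehmer_code \<sigma> i - 1)) ` {i. \<sigma> (Suc i) < \<sigma> i}"
      by (intro image_eqI[of _ _ "Suc i"]) auto
  qed
  ultimately show ?thesis by (simp only: set_eq_iff split_paired_All simp_thms)
qed

lemma diagram_next_smaller:
  assumes dom: "dominant n \<sigma>" and desc: "\<sigma> (Suc i) < \<sigma> i" and ns: "next_smaller \<sigma> i j"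
  shows "diagram (\<sigma> \<circ> transpose i j) = diagram \<sigma> - {(i - 1, lehmer_code \<sigma> i - 1)}"
proof -
  have i: "0 < i" using descent_pos desc dom by (auto simp: dominant_def)
  have same: "lehmer_code \<sigma> i = Suc (lehmer_code (\<sigma> \<circ> transpose i j) i)"
    using dom desc ns by (rule lehmer_code_next_smaller_same)
  have other: "lehmer_code (\<sigma> \<circ> transpose i j) k = lehmer_code \<sigma> k" if "k \<noteq> i" for k
    using dom desc ns that by (rule lehmer_code_next_smaller_other)
  have "(a, b) \<in> diagram (\<sigma> \<circ> transpose i j) \<longleftrightarrow> (a, b) \<in> diagram \<sigma> - {(i - 1, lehmer_code \<sigma> i - 1)}" for a b
    using same other[of "Suc a"] i by (cases "Suc a = i") (auto simp: diagram_def)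
  then show ?thesis by auto
qed

text \<open>Both numbers obey the same recursion: the descents of a dominant permutation correspond to
  the corners of its diagram, and by \<open>num_red_next_smaller\<close> the removal of the last letter \<open>i\<close>
  may be replaced, as far as counting is concerned, by the removal of the corner in the row of
  \<open>i\<close>.\<close>

lemma num_red_dominant:
  assumes "dominant n \<sigma>"
  shows "num_red \<sigma> = card (tableaux (diagram \<sigma>))"
  using assms
proof (induction "card (diagram \<sigma>)" arbitrary: \<sigma> rule: less_induct)
  case less
  note dom = less.prems
  have perm: "\<sigma> permutes {1..n}" using dom by (simp add: dominant_def)
  have fin: "finite (diagram \<sigma>)" using perm by (rule finite_diagram)
  let ?cell = "\<lambda>i. (i - 1, lehmer_code \<sigma> i - 1)"
  show ?case
  proof (cases "\<sigma> = id")
    case True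
    then show ?thesis by (simp only: red_id diagram_id card_tableaux_empty) simp
  next
    case False
    have "diagram \<sigma> \<noteq> diagram id"
      using False perm inj_onD[OF inj_on_diagram, of \<sigma> id] permutes_id by blast
    then have ne: "diagram \<sigma> \<noteq> {}" by (simp add: diagram_id)
    have step: "num_red (\<sigma> \<circ> swap i) = card (tableaux (diagram \<sigma> - {?cell i}))"
      if desc: "\<sigma> (Suc i) < \<sigma> i" for i
    proof -
      obtain j where ns: "next_smaller \<sigma> i j"
        using ex_next_smaller[of \<sigma> i] dominant_permutation[OF dom] desc by blast
      note d = diagram_next_smaller[OF dom desc ns]
      have "?cell i \<in> diagram \<sigma>" using desc corners_diagram[OF dom] by (auto simp: corners_def)
      then have "card (diagram (\<sigma> \<circ> transpose i j)) < card (diagram \<sigma>)"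
        unfolding d using fin by (rule card_Diff1_less[rotated])
      moreover have "dominant n (\<sigma> \<circ> transpose i j)"
        using dom desc ns by (rule dominant_next_smaller)
      ultimately have "num_red (\<sigma> \<circ> transpose i j) = card (tableaux (diagram (\<sigma> \<circ> transpose i j)))"
        by (rule less.hyps)
      then show ?thesis using num_red_next_smaller[OF dom desc ns] d by simp
    qed
    have inj: "inj_on ?cell {i. \<sigma> (Suc i) < \<sigma> i}"
    proof (rule inj_onI)
      fix a b assume "a \<in> {i. \<sigma> (Suc i) < \<sigma> i}" "b \<in> {i. \<sigma> (Suc i) < \<sigma> i}" "?cell a = ?cell b"
      then show "a = b" using descent_pos[OF perm, of a] descent_pos[OF perm, of b] by auto
    qed
    have "num_red \<sigma> = (\<Sum>i | \<sigma> (Suc i) < \<sigma> i. num_red (\<sigma> \<circ> swap i))"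
      using dominant_permutation[OF dom] False by (rule num_red_eq_sum_descents)
    also have "\<dots> = (\<Sum>i | \<sigma> (Suc i) < \<sigma> i. card (tableaux (diagram \<sigma> - {?cell i})))"
      using step by (intro sum.cong) auto
    also have "\<dots> = (\<Sum>c\<in>corners (diagram \<sigma>). card (tableaux (diagram \<sigma> - {c})))"
      unfolding corners_diagram[OF dom] by (simp only: sum.reindex[OF inj] o_def)
    also have "\<dots> = card (tableaux (diagram \<sigma>))"
      using card_tableaux_eq_sum_corners[OF fin order_ideal_diagram[OF dom] ne] by simp
    finally show ?thesis .
  qed
qed

section \<open>Partitions and dominant permutations inside the staircase\<close>

lemma down_closed_eq_lessThan:
  fixes S :: "nat set"
  assumes "finite S" "\<And>x y. x \<in> S \<Longrightarrow> y < x \<Longrightarrow> y \<in> S"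
  shows "S = {..<card S}"
proof -
  obtain m where "m \<notin> S" using assms(1) by (metis ex_new_if_finite infinite_UNIV_nat)
  then have least: "(LEAST m. m \<notin> S) \<notin> S" by (rule LeastI)
  have "S = {..<(LEAST m. m \<notin> S)}"
  proof (intro equalityI subsetI)
    fix x assume "x \<in> S"
    then show "x \<in> {..<(LEAST m. m \<notin> S)}"
      using least assms(2)[of x] by (metis lessThan_iff linorder_neqE_nat)
  next
    fix x assume "x \<in> {..<(LEAST m. m \<notin> S)}"
    then show "x \<in> S" using not_less_Least[of x "\<lambda>m. m \<notin> S"] by auto
  qed
  then show ?thesis by (metis card_lessThan)
qed

lemma card_young_diagram: "card (young_diagram l) = sum_list l"
proof -
  have "young_diagram l = (SIGMA i:{..<length l}. {..<l ! i})"
    by (auto simp: young_diagram_def)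
  then show ?thesis by (simp add: sum_list_sum_nth atLeast0LessThan)
qed

lemma SYT_eq_tableaux: "SYT l = tableaux (young_diagram l)"
  unfolding SYT_def tableaux_def card_young_diagram ..

lemma young_diagram_inject:
  assumes "is_partition l" "is_partition m" "young_diagram l = young_diagram m"
  shows "l = m"
proof (rule nth_equalityI)
  have pos: "i < length k \<longleftrightarrow> (i, 0) \<in> young_diagram k" if "is_partition k" for i k
    using that unfolding young_diagram_def is_partition_def by (auto intro!: gr0I) (metis nth_mem)
  have "i < length l \<longleftrightarrow> i < length m" for i
    using pos[OF assms(1)] pos[OF assms(2)] assms(3) by simp
  then show len: "length l = length m" by (metis linorder_neqE_nat less_irrefl)
  fix i assume i: "i < length l"
  have "j < l ! i \<longleftrightarrow> j < m ! i" for j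
    using assms(3) i len by (auto simp: young_diagram_def set_eq_iff)
  then show "l ! i = m ! i" by (metis linorder_neqE_nat less_irrefl)
qed

lemma order_ideal_young_diagram:
  assumes "is_partition l"
  shows "order_ideal (young_diagram l)"
  unfolding order_ideal_def
proof (intro allI impI)
  fix i j i' j' assume *: "(i, j) \<in> young_diagram l \<and> i' \<le> i \<and> j' \<le> j"
  then have "l ! i \<le> l ! i'"
    using assms
      by (cases "i' = i") (auto simp: is_partition_def young_diagram_def sorted_wrt_iff_nth_less)
  then show "(i', j') \<in> young_diagram l" using * by (auto simp: young_diagram_def)
qed

text \<open>In an order ideal each row, and also the first column, is an initial segment of the natural
  numbers, so the row lengths form a partition.\<close>

lemma order_ideal_eq_young_diagram:
  assumes fin: "finite Y" and ideal: "order_ideal Y"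
  shows "\<exists>l. is_partition l \<and> young_diagram l = Y"
proof -
  define row where "row i = card {j. (i, j) \<in> Y}" for i
  define len where "len = card {i. (i, 0) \<in> Y}"
  have "finite {j. (i, j) \<in> Y}" for i
    using fin by (rule finite_surj[of _ _ snd]) force
  then have "{j. (i, j) \<in> Y} = {..<row i}" for i
    unfolding row_def using order_idealD[OF ideal] by (intro down_closed_eq_lessThan) auto
  then have row: "(i, j) \<in> Y \<longleftrightarrow> j < row i" for i j by blast
  have "finite {i. (i, 0) \<in> Y}"
    using fin by (rule finite_surj[of _ _ fst]) force
  then have "{i. (i, 0) \<in> Y} = {..<len}"
    unfolding len_def using order_idealD[OF ideal] by (intro down_closed_eq_lessThan) auto
  then have len: "(i, 0) \<in> Y \<longleftrightarrow> i < len" for i by blast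
  let ?l = "map row [0..<len]"
  have "row k \<le> row i" if "i \<le> k" for i k
  proof (rule ccontr)
    assume "\<not> row k \<le> row i"
    then have "(k, row i) \<in> Y" by (simp add: row)
    then have "(i, row i) \<in> Y" using ideal that by (blast intro: order_idealD)
    then show False by (simp add: row)
  qed
  then have "sorted_wrt (\<ge>) ?l" by (simp add: sorted_wrt_iff_nth_less)
  moreover have "0 \<notin> set ?l"
  proof
    assume "0 \<in> set ?l"
    then obtain i where "i < len" "row i = 0" by auto
    then show False using len[of i] row[of i 0] by simp
  qed
  moreover have "young_diagram ?l = Y"
  proof -
    have "(i, j) \<in> young_diagram ?l \<longleftrightarrow> (i, j) \<in> Y" for i j
      using row[of i j] len[of i] order_idealD[OF ideal, of i j i 0]
      by (auto simp: young_diagram_def)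
    then show ?thesis by auto
  qed
  ultimately show ?thesis unfolding is_partition_def by blast
qed

lemma bij_betw_young_diagram:
  "bij_betw young_diagram (partitions_in m) {Y. order_ideal Y \<and> Y \<subseteq> young_diagram m}"
proof (rule bij_betw_imageI)
  show "inj_on young_diagram (partitions_in m)"
    by (auto simp: inj_on_def partitions_in_def intro: young_diagram_inject)
  show "young_diagram ` partitions_in m = {Y. order_ideal Y \<and> Y \<subseteq> young_diagram m}"
  proof (intro equalityI subsetI)
    fix Y assume "Y \<in> {Y. order_ideal Y \<and> Y \<subseteq> young_diagram m}"
    then have Y: "order_ideal Y" "Y \<subseteq> young_diagram m" by simp_all
    then obtain l where "is_partition l" "young_diagram l = Y"
      using order_ideal_eq_young_diagram finite_young_diagram finite_subset by metis
    then show "Y \<in> young_diagram ` partitions_in m" using Y by (auto simp: partitions_in_def)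
  qed (auto simp: partitions_in_def order_ideal_young_diagram)
qed

text \<open>The longest element of the symmetric group on \<open>{1..n}\<close>.\<close>

definition reversal :: "nat \<Rightarrow> nat \<Rightarrow> nat" where
  "reversal n i = (if i \<in> {1..n} then Suc n - i else i)"

lemma reversal_involutory [simp]: "reversal n (reversal n i) = i"
  by (auto simp: reversal_def)

lemma reversal_permutes: "reversal n permutes {1..n}"
  by (rule bij_imp_permutes[OF bij_betwI[where g = "reversal n"]]) (auto simp: reversal_def)

lemma diagram_reversal: "diagram (reversal n) = young_diagram (staircase n)"
proof -
  have "lehmer_code (reversal n) (Suc i) = n - Suc i" for i
  proof -
    have "{j. Suc i < j \<and> reversal n j < reversal n (Suc i)} = {Suc i<..n}"
      by (auto simp: reversal_def split: if_splits)
    then show ?thesis unfolding lehmer_code_def by simp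
  qed
  then show ?thesis by (auto simp: diagram_def young_diagram_staircase)
qed

lemma dominant_reversal: "dominant n (reversal n)"
  unfolding dominant_def
  by (intro conjI reversal_permutes) (auto simp: reversal_def)

text \<open>Start from the staircase, the diagram of the longest permutation, and remove corners: a
  minimal missing cell \<open>c\<close> is a corner of \<open>insert c Y\<close>, and the exchange of an entry with the
  next smaller one removes it from the diagram.\<close>

lemma ex_dominant_diagram:
  assumes "order_ideal Y" "Y \<subseteq> young_diagram (staircase n)"
  shows "\<exists>\<sigma>. dominant n \<sigma> \<and> diagram \<sigma> = Y"
  using assms
proof (induction "card (young_diagram (staircase n) - Y)" arbitrary: Y rule: less_induct)
  case less
  let ?SC = "young_diagram (staircase n)"
  show ?case
  proof (cases "Y = ?SC")
    case True
    then show ?thesis using dominant_reversal diagram_reversal by blast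
  next
    case False
    then have "\<exists>c. c \<in> ?SC - Y" using less.prems by blast
    then obtain c where c: "c \<in> ?SC - Y"
      and min: "\<And>d. d \<in> ?SC - Y \<Longrightarrow> fst c + snd c \<le> fst d + snd d"
      using ex_has_least_nat[of "\<lambda>c. c \<in> ?SC - Y" _ "\<lambda>c. fst c + snd c"] by blast
    obtain a b where ab: "c = (a, b)" by (cases c)
    have ideal: "order_ideal (insert c Y)"
      unfolding order_ideal_def
    proof (intro allI impI)
      fix i j i' j' assume *: "(i, j) \<in> insert c Y \<and> i' \<le> i \<and> j' \<le> j"
      show "(i', j') \<in> insert c Y"
      proof (cases "(i, j) = c")
        case True
        then have "(i', j') \<in> ?SC" using * c ab by (auto simp: young_diagram_staircase)
        moreover have "(i', j') = c \<or> i' + j' < a + b" using True * ab by auto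
        ultimately show ?thesis using min[of "(i', j')"] ab by auto
      next
        case False
        then show ?thesis using * less.prems(1) order_idealD[of Y i j i' j'] by simp
      qed
    qed
    have "card (?SC - insert c Y) < card (?SC - Y)"
      using c finite_young_diagram by (intro psubset_card_mono) auto
    then obtain \<sigma> where \<sigma>: "dominant n \<sigma>" "diagram \<sigma> = insert c Y"
      using less.hyps[of "insert c Y"] ideal less.prems c by blast
    have "c \<in> corners (diagram \<sigma>)"
      using order_idealD[OF less.prems(1), of "Suc a" b a b]
        order_idealD[OF less.prems(1), of a "Suc b" a b] c ab
      by (auto simp: corners_def \<sigma>)
    then obtain i where i: "\<sigma> (Suc i) < \<sigma> i" "c = (i - 1, lehmer_code \<sigma> i - 1)"
      using corners_diagram[OF \<sigma>(1)] by auto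
    obtain j where ns: "next_smaller \<sigma> i j"
      using ex_next_smaller i dominant_permutation[OF \<sigma>(1)] by blast
    have "diagram (\<sigma> \<circ> transpose i j) = insert c Y - {c}"
      using diagram_next_smaller[OF \<sigma>(1) i(1) ns] i(2) \<sigma>(2) by simp
    also have "\<dots> = Y" using c by blast
    finally show ?thesis using dominant_next_smaller[OF \<sigma>(1) i(1) ns] by blast
  qed
qed

lemma bij_betw_diagram:
  "bij_betw diagram {\<sigma>. dominant n \<sigma>}
     {Y. order_ideal Y \<and> Y \<subseteq> young_diagram (staircase n)}"
proof (rule bij_betw_imageI)
  show "inj_on diagram {\<sigma>. dominant n \<sigma>}"
    by (rule inj_on_subset[OF inj_on_diagram]) (auto simp: dominant_def)
  show "diagram ` {\<sigma>. dominant n \<sigma>} = {Y. order_ideal Y \<and> Y \<subseteq> young_diagram (staircase n)}"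
  proof (intro equalityI subsetI)
    fix Y assume "Y \<in> {Y. order_ideal Y \<and> Y \<subseteq> young_diagram (staircase n)}"
    then show "Y \<in> diagram ` {\<sigma>. dominant n \<sigma>}" using ex_dominant_diagram[of Y n] by blast
  next
    fix Y assume "Y \<in> diagram ` {\<sigma>. dominant n \<sigma>}"
    then obtain \<sigma> where "dominant n \<sigma>" "Y = diagram \<sigma>" by blast
    then show "Y \<in> {Y. order_ideal Y \<and> Y \<subseteq> young_diagram (staircase n)}"
      using order_ideal_diagram diagram_subset_staircase by (simp add: dominant_def)
  qed
qed

lemma sum_card_reduced_words_dominant:
  "(\<Sum>\<sigma> | dominant n \<sigma>. card (reduced_words n \<sigma>)) = (\<Sum>l\<in>partitions_in (staircase n). num_SYT l)"
proof -
  have "(\<Sum>\<sigma> | dominant n \<sigma>. card (reduced_words n \<sigma>)) =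
      (\<Sum>\<sigma> | dominant n \<sigma>. card (tableaux (diagram \<sigma>)))"
    by (intro sum.cong refl) (simp add: reduced_words_eq_red dominant_def num_red_dominant)
  also have "\<dots> = (\<Sum>Y | order_ideal Y \<and> Y \<subseteq> young_diagram (staircase n). card (tableaux Y))"
    using bij_betw_diagram by (rule sum.reindex_bij_betw)
  also have "\<dots> = (\<Sum>l\<in>partitions_in (staircase n). card (tableaux (young_diagram l)))"
    using bij_betw_young_diagram by (rule sum.reindex_bij_betw[symmetric])
  finally show ?thesis by (simp add: num_SYT_def SYT_eq_tableaux)
qed

section \<open>Pattern avoidance and the reversal symmetry\<close>

lemma subseq_Cons_drop_iff:
  "subseq (x # xs) (drop k w) \<longleftrightarrow>
     (\<exists>a\<ge>k. a < length w \<and> w ! a = x \<and> subseq xs (drop (Suc a) w))"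
proof
  assume "subseq (x # xs) (drop k w)"
  then obtain us vs where uv: "drop k w = us @ x # vs" "subseq xs vs" by (auto dest: list_emb_ConsD)
  have len: "length w - k = Suc (length us + length vs)" using arg_cong[OF uv(1), of length] by simp
  have "w ! (k + length us) = x" using nth_drop[of k w "length us"] len uv(1) by simp
  moreover have "drop (Suc (k + length us)) w = vs"
    using arg_cong[OF uv(1), of "drop (Suc (length us))"] by (simp add: add.commute)
  ultimately show "\<exists>a\<ge>k. a < length w \<and> w ! a = x \<and> subseq xs (drop (Suc a) w)"
    using uv(2) len by (intro exI[of _ "k + length us"]) auto
next
  assume "\<exists>a\<ge>k. a < length w \<and> w ! a = x \<and> subseq xs (drop (Suc a) w)"
  then obtain a where a: "k \<le> a" "a < length w" "w ! a = x" "subseq xs (drop (Suc a) w)" by blast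
  then have "subseq (x # xs) (drop a w)" by (simp flip: Cons_nth_drop_Suc)
  moreover have "drop k w = take (a - k) (drop k w) @ drop a w"
    using a(1) append_take_drop_id[of "a - k" "drop k w"] by simp
  ultimately show "subseq (x # xs) (drop k w)" by (metis list_emb_append2)
qed

lemma subseq_three_iff:
  "subseq [x, y, z] w \<longleftrightarrow>
     (\<exists>a b c. a < b \<and> b < c \<and> c < length w \<and> w ! a = x \<and> w ! b = y \<and> w ! c = z)"
proof -
  have eq: "subseq [x, y, z] w \<longleftrightarrow> (\<exists>a. a < length w \<and> w ! a = x \<and>
      (\<exists>b>a. b < length w \<and> w ! b = y \<and> (\<exists>c>b. c < length w \<and> w ! c = z)))"
    using subseq_Cons_drop_iff[of x "[y, z]" 0 w] by (simp add: subseq_Cons_drop_iff Suc_le_eq)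
  show ?thesis
    unfolding eq
  proof (intro iffI; elim exE conjE)
    fix a b c assume "a < b" "b < c" "c < length w" "w ! a = x" "w ! b = y" "w ! c = z"
    then show "\<exists>a. a < length w \<and> w ! a = x \<and>
      (\<exists>b>a. b < length w \<and> w ! b = y \<and> (\<exists>c>b. c < length w \<and> w ! c = z))"
      by (intro exI[of _ a] exI[of _ b] exI[of _ c] conjI) simp_all
  qed blast
qed

lemma ex_subseq_one_line_iff:
  "(\<exists>x y z. subseq [x, y, z] (one_line n \<sigma>) \<and> P x y z) \<longleftrightarrow>
   (\<exists>a b c. 0 < a \<and> a < b \<and> b < c \<and> c \<le> n \<and> P (\<sigma> a) (\<sigma> b) (\<sigma> c))" (is "?l \<longleftrightarrow> ?r")
proof -
  have nth: "one_line n \<sigma> ! a = \<sigma> (Suc a)" if "a < n" for a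
    using that by (simp add: one_line_def del: upt_Suc)
  have len: "length (one_line n \<sigma>) = n" by (simp add: one_line_def)
  show ?thesis
  proof
    assume ?l
    then obtain a b c where abc: "a < b" "b < c" "c < n"
      and P: "P (one_line n \<sigma> ! a) (one_line n \<sigma> ! b) (one_line n \<sigma> ! c)"
      unfolding subseq_three_iff len by blast
    have "P (\<sigma> (Suc a)) (\<sigma> (Suc b)) (\<sigma> (Suc c))" using P abc nth by simp
    then show ?r
      using abc by (intro exI[of _ "Suc a"] exI[of _ "Suc b"] exI[of _ "Suc c"]) simp
  next
    assume ?r
    then obtain a b c where abc: "0 < a" "a < b" "b < c" "c \<le> n" "P (\<sigma> a) (\<sigma> b) (\<sigma> c)" by blast
    then have "subseq [\<sigma> a, \<sigma> b, \<sigma> c] (one_line n \<sigma>)"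
      unfolding subseq_three_iff len using nth[of "a - 1"] nth[of "b - 1"] nth[of "c - 1"]
      by (intro exI[of _ "a - 1"] exI[of _ "b - 1"] exI[of _ "c - 1"]) auto
    then show ?l using abc(5) by blast
  qed
qed

lemma same_order_132_iff: "same_order u [1, 3, 2] \<longleftrightarrow> (\<exists>x y z. u = [x, y, z] \<and> x < z \<and> z < y)"
proof
  assume so: "same_order u [1, 3, 2]"
  then have "length u = Suc (Suc (Suc 0))" by (simp add: same_order_def)
  then obtain x y z where "u = [x, y, z]" by (auto simp: length_Suc_conv)
  then show "\<exists>x y z. u = [x, y, z] \<and> x < z \<and> z < y"
    using so by (auto simp: same_order_def All_less_Suc2)
qed (auto simp: same_order_def All_less_Suc2)

lemma same_order_213_iff: "same_order u [2, 1, 3] \<longleftrightarrow> (\<exists>x y z. u = [x, y, z] \<and> y < x \<and> x < z)"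
proof
  assume so: "same_order u [2, 1, 3]"
  then have "length u = Suc (Suc (Suc 0))" by (simp add: same_order_def)
  then obtain x y z where "u = [x, y, z]" by (auto simp: length_Suc_conv)
  then show "\<exists>x y z. u = [x, y, z] \<and> y < x \<and> x < z"
    using so by (auto simp: same_order_def All_less_Suc2)
qed (auto simp: same_order_def All_less_Suc2)

lemma avoids_132_iff:
  "avoids (one_line n \<sigma>) [1, 3, 2] \<longleftrightarrow>
     \<not> (\<exists>a b c. 0 < a \<and> a < b \<and> b < c \<and> c \<le> n \<and> \<sigma> a < \<sigma> c \<and> \<sigma> c < \<sigma> b)"
  using ex_subseq_one_line_iff[of n \<sigma> "\<lambda>x y z. x < z \<and> z < y"]
  unfolding avoids_def same_order_132_iff by blast

lemma avoids_213_iff: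
  "avoids (one_line n \<sigma>) [2, 1, 3] \<longleftrightarrow>
     \<not> (\<exists>a b c. 0 < a \<and> a < b \<and> b < c \<and> c \<le> n \<and> \<sigma> b < \<sigma> a \<and> \<sigma> a < \<sigma> c)"
  using ex_subseq_one_line_iff[of n \<sigma> "\<lambda>x y z. y < x \<and> x < z"]
  unfolding avoids_def same_order_213_iff by blast

lemma avoiding_perms_132: "avoiding_perms n [1, 3, 2] = {\<sigma>. dominant n \<sigma>}"
proof -
  have "c \<le> n" if perm: "\<sigma> permutes {1..n}" and "b < c" "\<sigma> c < \<sigma> b" for \<sigma> b c
  proof (rule ccontr)
    assume "\<not> c \<le> n"
    then have "\<sigma> c = c" using permutes_not_in[OF perm, of c] by simp
    then have "\<sigma> b \<notin> {1..n}" using that \<open>\<not> c \<le> n\<close> by simp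
    then have "\<sigma> b = b" using permutes_in_image[OF perm, of b] permutes_not_in[OF perm, of b]
      by blast
    then show False using that \<open>\<sigma> c = c\<close> by simp
  qed
  then show ?thesis unfolding avoiding_perms_def dominant_def avoids_132_iff by blast
qed

lemma reversal_less_iff: "a \<in> {1..n} \<Longrightarrow> b \<in> {1..n} \<Longrightarrow> reversal n a < reversal n b \<longleftrightarrow> b < a"
  by (auto simp: reversal_def)

lemma reversal_mem [simp]: "reversal n a \<in> {1..n} \<longleftrightarrow> a \<in> {1..n}"
  by (auto simp: reversal_def)

text \<open>Reverse and complement of the one-line word, which carries the pattern 132 to 213.\<close>

definition conj_reversal :: "nat \<Rightarrow> (nat \<Rightarrow> nat) \<Rightarrow> nat \<Rightarrow> nat" where
  "conj_reversal n \<sigma> = reversal n \<circ> \<sigma> \<circ> reversal n"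

lemma conj_reversal_involutory [simp]: "conj_reversal n (conj_reversal n \<sigma>) = \<sigma>"
  by (simp add: conj_reversal_def fun_eq_iff)

lemma conj_reversal_permutes:
  "\<sigma> permutes {1..n} \<Longrightarrow> conj_reversal n \<sigma> permutes {1..n}"
  unfolding conj_reversal_def by (intro permutes_compose reversal_permutes)

lemma conj_reversal_less_iff:
  assumes "\<sigma> permutes {1..n}" "a \<in> {1..n}" "b \<in> {1..n}"
  shows "conj_reversal n \<sigma> a < conj_reversal n \<sigma> b \<longleftrightarrow> \<sigma> (reversal n b) < \<sigma> (reversal n a)"
  unfolding conj_reversal_def o_def
  using assms by (intro reversal_less_iff) (simp_all only: permutes_in_image reversal_mem)

lemma avoids_132_conj_reversal:
  assumes perm: "\<sigma> permutes {1..n}" and "avoids (one_line n \<sigma>) [1, 3, 2]"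
  shows "avoids (one_line n (conj_reversal n \<sigma>)) [2, 1, 3]"
  unfolding avoids_213_iff
proof
  let ?r = "reversal n" and ?c = "conj_reversal n \<sigma>"
  assume "\<exists>a b c. 0 < a \<and> a < b \<and> b < c \<and> c \<le> n \<and> ?c b < ?c a \<and> ?c a < ?c c"
  then obtain a b c where abc: "0 < a" "a < b" "b < c" "c \<le> n" "?c b < ?c a" "?c a < ?c c" by blast
  then have mem: "a \<in> {1..n}" "b \<in> {1..n}" "c \<in> {1..n}" by auto
  have "?r c < ?r b" "?r b < ?r a" using abc mem by (simp_all only: reversal_less_iff)
  moreover have "0 < ?r c" "?r a \<le> n" using mem by (auto simp: reversal_def)
  moreover have "\<sigma> (?r c) < \<sigma> (?r a)" "\<sigma> (?r a) < \<sigma> (?r b)"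
    using abc conj_reversal_less_iff[OF perm] mem by blast+
  ultimately show False using assms(2) unfolding avoids_132_iff by blast
qed

lemma avoids_213_conj_reversal:
  assumes perm: "\<sigma> permutes {1..n}" and "avoids (one_line n \<sigma>) [2, 1, 3]"
  shows "avoids (one_line n (conj_reversal n \<sigma>)) [1, 3, 2]"
  unfolding avoids_132_iff
proof
  let ?r = "reversal n" and ?c = "conj_reversal n \<sigma>"
  assume "\<exists>a b c. 0 < a \<and> a < b \<and> b < c \<and> c \<le> n \<and> ?c a < ?c c \<and> ?c c < ?c b"
  then obtain a b c where abc: "0 < a" "a < b" "b < c" "c \<le> n" "?c a < ?c c" "?c c < ?c b" by blast
  then have mem: "a \<in> {1..n}" "b \<in> {1..n}" "c \<in> {1..n}" by auto
  have "?r c < ?r b" "?r b < ?r a" using abc mem by (simp_all only: reversal_less_iff)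
  moreover have "0 < ?r c" "?r a \<le> n" using mem by (auto simp: reversal_def)
  moreover have "\<sigma> (?r b) < \<sigma> (?r c)" "\<sigma> (?r c) < \<sigma> (?r a)"
    using abc conj_reversal_less_iff[OF perm] mem by blast+
  ultimately show False using assms(2) unfolding avoids_213_iff by blast
qed

lemma bij_betw_conj_reversal:
  "bij_betw (conj_reversal n) (avoiding_perms n [1, 3, 2]) (avoiding_perms n [2, 1, 3])"
  by (rule bij_betwI[where g = "conj_reversal n"])
     (auto simp: avoiding_perms_def conj_reversal_permutes avoids_132_conj_reversal
       avoids_213_conj_reversal simp del: One_nat_def)

lemma inv_count_conj_reversal:
  assumes "\<sigma> permutes {1..n}"
  shows "inv_count n (conj_reversal n \<sigma>) = inv_count n \<sigma>"
proof -
  let ?I = "\<lambda>\<sigma>. {(i, j). 1 \<le> i \<and> i < j \<and> j \<le> n \<and> \<sigma> j < \<sigma> i}"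
  let ?f = "\<lambda>(i, j). (reversal n j, reversal n i)"
  have sub: "?f ` ?I \<sigma> \<subseteq> ?I (conj_reversal n \<sigma>)" if "\<sigma> permutes {1..n}" for \<sigma>
  proof clarify
    fix i j assume ij: "1 \<le> i" "i < j" "j \<le> n" "\<sigma> j < \<sigma> i"
    then have mem: "i \<in> {1..n}" "j \<in> {1..n}" by auto
    then have "conj_reversal n \<sigma> (reversal n i) < conj_reversal n \<sigma> (reversal n j)"
      using conj_reversal_less_iff[OF that, of "reversal n i" "reversal n j"] ij(4)
      by (simp only: reversal_mem reversal_involutory)
    moreover have "reversal n j < reversal n i" using mem ij by (simp only: reversal_less_iff)
    moreover have "1 \<le> reversal n j" "reversal n i \<le> n" using mem by (auto simp: reversal_def)
    ultimately show "1 \<le> reversal n j \<and> reversal n j < reversal n i \<and> reversal n i \<le> n \<and>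
        conj_reversal n \<sigma> (reversal n i) < conj_reversal n \<sigma> (reversal n j)" by simp
  qed
  have "bij_betw ?f (?I \<sigma>) (?I (conj_reversal n \<sigma>))"
  proof (rule bij_betwI[where g = ?f])
    show "?f \<in> ?I \<sigma> \<rightarrow> ?I (conj_reversal n \<sigma>)" 
      using sub[OF assms] by (simp only: image_subset_iff_funcset)
    show "?f \<in> ?I (conj_reversal n \<sigma>) \<rightarrow> ?I \<sigma>"
      using sub[OF conj_reversal_permutes[OF assms]]
      by (simp only: conj_reversal_involutory image_subset_iff_funcset)
  qed auto
  then show ?thesis unfolding inv_count_def by (rule bij_betw_same_card[symmetric])
qed

text \<open>Conjugation by the longest element sends the simple transposition \<open>i\<close> to \<open>n - i\<close>.\<close>

lemma word_perm_map_reversal: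
  assumes "set w \<subseteq> {1..<n}"
  shows "word_perm (map (\<lambda>i. n - i) w) = conj_reversal n (word_perm w)"
  using assms
proof (induction w rule: rev_induct)
  case Nil
  show ?case by (simp only: list.map word_perm_Nil) (simp add: conj_reversal_def fun_eq_iff)
next
  case (snoc i w)
  have i: "1 \<le> i" "i < n" using snoc.prems by auto
  have swap: "reversal n (swap (n - i) x) = swap i (reversal n x)" for x
    using i by (auto simp: reversal_def transpose_def split: if_splits)
  have "word_perm (map (\<lambda>i. n - i) w) \<circ> swap (n - i) = conj_reversal n (word_perm w \<circ> swap i)"
    using snoc by (simp add: conj_reversal_def fun_eq_iff swap)
  then show ?case by (simp only: map_append list.map word_perm_snoc)
qed

lemma card_reduced_words_conj_reversal:
  assumes "\<sigma> permutes {1..n}"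
  shows "card (reduced_words n (conj_reversal n \<sigma>)) = card (reduced_words n \<sigma>)"
proof -
  let ?f = "map (\<lambda>i. n - i)"
  have sub: "?f w \<in> reduced_words n (conj_reversal n \<sigma>)"
    if "\<sigma> permutes {1..n}" "w \<in> reduced_words n \<sigma>" for \<sigma> w
  proof -
    have w: "set w \<subseteq> {1..<n}" "length w = inv_count n \<sigma>" "word_perm w = \<sigma>"
      using that(2) by (simp_all add: reduced_words_def)
    have "set (?f w) \<subseteq> {1..<n}" using w(1) by force
    moreover have "word_perm (?f w) = conj_reversal n \<sigma>"
      using word_perm_map_reversal[OF w(1)] w(3) by simp
    moreover have "length (?f w) = inv_count n (conj_reversal n \<sigma>)"
      using inv_count_conj_reversal[OF that(1)] w(2) by simp
    ultimately show ?thesis unfolding reduced_words_def by blast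
  qed
  have inv: "?f (?f w) = w" if "w \<in> reduced_words n \<sigma>" for w \<sigma>
    using that by (auto simp: reduced_words_def intro!: map_idI)
  have "bij_betw ?f (reduced_words n \<sigma>) (reduced_words n (conj_reversal n \<sigma>))"
    using sub[OF assms] sub[OF conj_reversal_permutes[OF assms]] inv
    by (intro bij_betwI[where g = ?f]) auto
  then show ?thesis by (rule bij_betw_same_card[symmetric])
qed

theorem corollary3p10:
  fixes n :: nat and p :: "nat list"
  assumes "p \<in> {[1, 3, 2], [2, 1, 3]}"
  shows "card (\<Union>\<sigma>\<in>avoiding_perms n p. reduced_words n \<sigma>)
         = (\<Sum>l\<in>partitions_in (staircase n). num_SYT l)"
proof -
  have perm: "\<sigma> permutes {1..n}" if "\<sigma> \<in> avoiding_perms n q" for \<sigma> q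
    using that by (simp add: avoiding_perms_def)
  have "card (\<Union>\<sigma>\<in>avoiding_perms n p. reduced_words n \<sigma>) =
      (\<Sum>\<sigma>\<in>avoiding_perms n p. card (reduced_words n \<sigma>))"
  proof (rule card_UN_disjoint)
    show "finite (avoiding_perms n p)"
      by (rule finite_subset[OF _ finite_permutations[of "{1..n}"]]) (use perm in blast, simp)
    show "\<forall>\<sigma>\<in>avoiding_perms n p. finite (reduced_words n \<sigma>)"
    proof
      fix \<sigma> assume "\<sigma> \<in> avoiding_perms n p"
      then have \<sigma>: "\<sigma> permutes {1..n}" by (rule perm)
      then have "permutation \<sigma>" by (auto simp: permutation_permutes)
      then show "finite (reduced_words n \<sigma>)"
        unfolding reduced_words_eq_red[OF \<sigma>] by (rule finite_red)
    qed
    show "\<forall>\<sigma>\<in>avoiding_perms n p. \<forall>\<tau>\<in>avoiding_perms n p.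
        \<sigma> \<noteq> \<tau> \<longrightarrow> reduced_words n \<sigma> \<inter> reduced_words n \<tau> = {}"
      by (auto simp: reduced_words_def)
  qed
  also have "\<dots> = (\<Sum>\<sigma>\<in>avoiding_perms n [1, 3, 2]. card (reduced_words n \<sigma>))"
  proof (cases "p = [1, 3, 2]")
    case False
    then have p: "p = [2, 1, 3]" using assms by simp
    have "(\<Sum>\<sigma>\<in>avoiding_perms n [2, 1, 3]. card (reduced_words n \<sigma>)) =
        (\<Sum>\<sigma>\<in>avoiding_perms n [1, 3, 2]. card (reduced_words n (conj_reversal n \<sigma>)))"
      using bij_betw_conj_reversal by (rule sum.reindex_bij_betw[symmetric])
    also have "\<dots> = (\<Sum>\<sigma>\<in>avoiding_perms n [1, 3, 2]. card (reduced_words n \<sigma>))"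
      by (intro sum.cong refl card_reduced_words_conj_reversal perm)
    finally show ?thesis using p by simp
  qed simp
  also have "\<dots> = (\<Sum>l\<in>partitions_in (staircase n). num_SYT l)"
    unfolding avoiding_perms_132 by (rule sum_card_reduced_words_dominant)
  finally show ?thesis .
qed

end
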